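(* Let $\mathcal{H}$ be an infinite dimensional separable complex Hilbert space, let $\mathbb{T}$ be the perimeter of the unit disc in $\mathbb{C}$, and let $\mathcal{A}\subset\mathcal{B}(\mathcal{H})$ be any extension of $\mathcal{C}(\mathcal{H})$ by $C(\mathbb{T})$. Then there is a sequence of $*$-automorphisms of $\mathcal{A}$ which converges pointwise (in the norm of $\mathcal{A}$) to a nonsurjective $*$-endomorphism of $\mathcal{A}$. Therefore, the automorphism group as well as the isometry group of $\mathcal{A}$ are topologically nonreflexive (i.e. not topologically reflexive).
   Context: For a Banach space $\mathcal{X}$, $\mathcal{B}(\mathcal{X})$ denotes the algebra of all bounded linear operators on $\mathcal{X}$. A subset $\mathcal{E}\subset\mathcal{B}(\mathcal{X})$ is called topologically reflexive if for every $T\in\mathcal{B}(\mathcal{X})$, the condition that $Tx\in\overline{\mathcal{E}x}$ (norm closure of $\mathcal{E}x=\{Ex : E\in\mathcal{E}\}$) for every $x\in\mathcal{X}$ implies $T\in\mathcal{E}$. $\mathcal{C}(\mathcal{H})$ is the algebra of all compact operators on $\mathcal{H}$, and $C(\mathbb{T})$ is the $C^*$-algebra of all continuous complex valued functions on $\mathbb{T}$. A subalgebra of $\mathcal{B}(\mathcal{H})$ is called standard if it contains all finite rank operators; a standard $C^*$-algebra is a $C^*$-subalgebra of $\mathcal{B}(\mathcal{H})$ that is standard. An extension of $\mathcal{C}(\mathcal{H})$ by $C(\mathbb{T})$ is a standard $C^*$-algebra $\mathcal{A}\subset\mathcal{B}(\mathcal{H})$ together with a surjective $*$-homomorphism $\phi:\mathcal{A}\to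 C(\mathbb{T})$ whose kernel is $\mathcal{C}(\mathcal{H})$. An automorphism of an algebra is a multiplicative linear bijection of the algebra onto itself (not assumed to be $*$-preserving); a $*$-automorphism is an automorphism that preserves the $*$-operation. The automorphism group of $\mathcal{A}$ is the set of all its automorphisms, and the isometry group of $\mathcal{A}$ is the set of all surjective linear isometries of $\mathcal{A}$; both are regarded as subsets of $\mathcal{B}(\mathcal{A})$. *)

theory Defs
  imports "HOL-Analysis.Analysis"
begin

section \<open>Complex Hilbert spaces\<close>

class complex_normed_vector = real_normed_vector +
  fixes scaleC :: "complex \<Rightarrow> 'a \<Rightarrow> 'a"  (infixr \<open>*\<^sub>C\<close> 75)
  assumes scaleC_add_right: "c *\<^sub>C (x + y) = c *\<^sub>C x + c *\<^sub>C y"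
    and scaleC_add_left: "(c + d) *\<^sub>C x = c *\<^sub>C x + d *\<^sub>C x"
    and scaleC_scaleC: "c *\<^sub>C (d *\<^sub>C x) = (c * d) *\<^sub>C x"
    and scaleC_of_real: "complex_of_real r *\<^sub>C x = r *\<^sub>R x"
    and norm_scaleC: "norm (c *\<^sub>C x) = cmod c * norm x"

global_interpretation cvec: vector_space
  "scaleC :: complex \<Rightarrow> 'a \<Rightarrow> 'a::complex_normed_vector"
proof
  show "1 *\<^sub>C x = x" for x :: 'a
    using scaleC_of_real[of 1 x] by simp
qed (simp_all add: scaleC_add_right scaleC_add_left scaleC_scaleC)

text \<open>The inner product is linear in its first argument.\<close>

class complex_hilbert_space = complex_normed_vector + banach +
  fixes cinner :: "'a \<Rightarrow> 'a \<Rightarrow> complex"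
  assumes cinner_commute: "cinner x y = cnj (cinner y x)"
    and cinner_add_left: "cinner (x + y) z = cinner x z + cinner y z"
    and cinner_scaleC_left: "cinner (c *\<^sub>C x) y = c * cinner x y"
    and cinner_self: "cinner x x = complex_of_real ((norm x)\<^sup>2)"

section \<open>Bounded operators on a Hilbert space\<close>

instantiation blinfun :: (real_normed_vector, complex_normed_vector) complex_normed_vector
begin

lift_definition scaleC_blinfun :: "complex \<Rightarrow> ('a \<Rightarrow>\<^sub>L 'b) \<Rightarrow> ('a \<Rightarrow>\<^sub>L 'b)"
  is "\<lambda>c f x. c *\<^sub>C f x"
proof -
  fix c :: complex and f :: "'a \<Rightarrow> 'b"
  assume f: "bounded_linear f"
  have "bounded_linear (\<lambda>y::'b. c *\<^sub>C y)"
  proof (rule bounded_linear_intro)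
    show "c *\<^sub>C (x + y) = c *\<^sub>C x + c *\<^sub>C y" for x y :: 'b
      by (rule scaleC_add_right)
    show "c *\<^sub>C (r *\<^sub>R x) = r *\<^sub>R (c *\<^sub>C x)" for r and x :: 'b
      by (simp add: scaleC_of_real[symmetric] scaleC_scaleC mult.commute)
    show "norm (c *\<^sub>C x) \<le> norm x * cmod c" for x :: 'b
      by (simp add: norm_scaleC mult.commute)
  qed
  from bounded_linear_compose[OF this f] show "bounded_linear (\<lambda>x. c *\<^sub>C f x)" .
qed

instance
proof
  fix c d :: complex and r :: real and f g :: "'a \<Rightarrow>\<^sub>L 'b"
  show "c *\<^sub>C (f + g) = c *\<^sub>C f + c *\<^sub>C g"
    by transfer (simp add: scaleC_add_right)
  show "(c + d) *\<^sub>C f = c *\<^sub>C f + d *\<^sub>C f"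
    by transfer (simp add: scaleC_add_left)
  show mult: "c *\<^sub>C (d *\<^sub>C f) = (c * d) *\<^sub>C f" for c d and f :: "'a \<Rightarrow>\<^sub>L 'b"
    by transfer (simp add: scaleC_scaleC)
  show real: "complex_of_real r *\<^sub>C f = r *\<^sub>R f" for r and f :: "'a \<Rightarrow>\<^sub>L 'b"
    by transfer (simp add: scaleC_of_real)
  have le: "norm (c *\<^sub>C f) \<le> cmod c * norm f" for c and f :: "'a \<Rightarrow>\<^sub>L 'b"
  proof (rule norm_blinfun_bound)
    fix x
    have "norm (blinfun_apply (c *\<^sub>C f) x) = cmod c * norm (blinfun_apply f x)"
      by transfer (simp add: norm_scaleC)
    also have "\<dots> \<le> cmod c * (norm f * norm x)"
      by (intro mult_left_mono norm_blinfun) simp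
    finally show "norm (blinfun_apply (c *\<^sub>C f) x) \<le> cmod c * norm f * norm x"
      by (simp add: mult.assoc)
  qed simp
  show "norm (c *\<^sub>C f) = cmod c * norm f"
  proof (cases "c = 0")
    case True
    then show ?thesis using real[of 0 f] by simp
  next
    case False
    have "norm f = norm (inverse c *\<^sub>C (c *\<^sub>C f))"
      using real[of 1 f] False by (simp add: mult)
    also have "\<dots> \<le> inverse (cmod c) * norm (c *\<^sub>C f)"
      using le[of "inverse c" "c *\<^sub>C f"] by (simp add: norm_inverse)
    finally have "cmod c * norm f \<le> norm (c *\<^sub>C f)"
      using False by (simp add: field_simps)
    with le[of c f] show ?thesis by simp
  qed
qed

end

text \<open>
  The type \<open>'h \<Rightarrow>\<^sub>L 'h\<close> consists of the bounded real-linear operators with the operator norm;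
  \<open>B(H)\<close> is the closed subalgebra of those that are complex-linear.
\<close>

definition cbounded_ops :: "('h::complex_normed_vector \<Rightarrow>\<^sub>L 'h) set" where
  "cbounded_ops = {T. \<forall>c x. blinfun_apply T (c *\<^sub>C x) = c *\<^sub>C blinfun_apply T x}"

text \<open>The operator described below exists and is unique by the Riesz representation theorem.\<close>

definition adj :: "('h::complex_hilbert_space \<Rightarrow>\<^sub>L 'h) \<Rightarrow> ('h \<Rightarrow>\<^sub>L 'h)" where
  "adj T = (THE S. \<forall>x y. cinner (blinfun_apply T x) y = cinner x (blinfun_apply S y))"

definition compact_ops :: "('h::complex_normed_vector \<Rightarrow>\<^sub>L 'h) set" where
  "compact_ops = {T \<in> cbounded_ops. compact (closure (blinfun_apply T ` cball 0 1))}"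

definition finite_rank_ops :: "('h::complex_normed_vector \<Rightarrow>\<^sub>L 'h) set" where
  "finite_rank_ops =
    {T \<in> cbounded_ops. \<exists>B. finite B \<and> range (blinfun_apply T) \<subseteq> cvec.span B}"

definition infinite_dimensional :: "'h::complex_normed_vector itself \<Rightarrow> bool" where
  "infinite_dimensional _ \<longleftrightarrow> \<not> (\<exists>B :: 'h set. finite B \<and> cvec.span B = UNIV)"

section \<open>Operator algebras and extensions\<close>

definition cstar_subalgebra :: "('h::complex_hilbert_space \<Rightarrow>\<^sub>L 'h) set \<Rightarrow> bool" where
  "cstar_subalgebra A \<longleftrightarrow>
    A \<subseteq> cbounded_ops \<and> cvec.subspace A \<and>
    (\<forall>a\<in>A. \<forall>b\<in>A. a o\<^sub>L b \<in> A) \<and> (\<forall>a\<in>A. adj a \<in> A) \<and> closed A"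

definition standard_cstar_algebra :: "('h::complex_hilbert_space \<Rightarrow>\<^sub>L 'h) set \<Rightarrow> bool" where
  "standard_cstar_algebra A \<longleftrightarrow> cstar_subalgebra A \<and> finite_rank_ops \<subseteq> A"

abbreviation unit_circle :: "complex set" where
  "unit_circle \<equiv> sphere 0 1"

text \<open>
  Functions on a subset are represented by total functions that are \<^const>\<open>undefined\<close>
  outside it, so that equality is equality on the subset.
\<close>

definition C_circle :: "(complex \<Rightarrow> complex) set" where
  "C_circle = {f \<in> extensional unit_circle. continuous_on unit_circle f}"

definition is_extension ::
  "('h::complex_hilbert_space \<Rightarrow>\<^sub>L 'h) set \<Rightarrow> (('h \<Rightarrow>\<^sub>L 'h) \<Rightarrow> complex \<Rightarrow> complex) \<Rightarrow> bool" where
  "is_extension A \<phi> \<longleftrightarrow>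
    standard_cstar_algebra A \<and>
    \<phi> ` A = C_circle \<and>
    (\<forall>a\<in>A. \<forall>b\<in>A. \<forall>z\<in>unit_circle. \<phi> (a + b) z = \<phi> a z + \<phi> b z) \<and>
    (\<forall>c. \<forall>a\<in>A. \<forall>z\<in>unit_circle. \<phi> (c *\<^sub>C a) z = c * \<phi> a z) \<and>
    (\<forall>a\<in>A. \<forall>b\<in>A. \<forall>z\<in>unit_circle. \<phi> (a o\<^sub>L b) z = \<phi> a z * \<phi> b z) \<and>
    (\<forall>a\<in>A. \<forall>z\<in>unit_circle. \<phi> (adj a) z = cnj (\<phi> a z)) \<and>
    {a \<in> A. \<forall>z\<in>unit_circle. \<phi> a z = 0} = compact_ops"

section \<open>Maps on a subspace, and topological reflexivity\<close>

definition clinear_on ::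
  "'x::complex_normed_vector set \<Rightarrow> ('x \<Rightarrow> 'y::complex_normed_vector) \<Rightarrow> bool" where
  "clinear_on X T \<longleftrightarrow>
    (\<forall>x\<in>X. \<forall>y\<in>X. T (x + y) = T x + T y) \<and> (\<forall>c. \<forall>x\<in>X. T (c *\<^sub>C x) = c *\<^sub>C T x)"

text \<open>\<open>B(X)\<close> for a (closed) subspace \<open>X\<close> of a complex normed space.\<close>

definition bounded_ops_on :: "'x::complex_normed_vector set \<Rightarrow> ('x \<Rightarrow> 'x) set" where
  "bounded_ops_on X =
    {T \<in> X \<rightarrow>\<^sub>E X. clinear_on X T \<and> (\<exists>K. \<forall>x\<in>X. norm (T x) \<le> K * norm x)}"

text \<open>
  The closure is taken in the ambient space, which for a closed \<open>X\<close> and maps of \<open>X\<close> into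
  itself is the closure in \<open>X\<close>.  The requirement \<open>E \<subseteq> bounded_ops_on X\<close> is deliberately not a
  conjunct: otherwise its failure would count as nonreflexivity.
\<close>

definition topologically_reflexive ::
  "'x::complex_normed_vector set \<Rightarrow> ('x \<Rightarrow> 'x) set \<Rightarrow> bool" where
  "topologically_reflexive X E \<longleftrightarrow>
    (\<forall>T\<in>bounded_ops_on X. (\<forall>x\<in>X. T x \<in> closure {F x | F. F \<in> E}) \<longrightarrow> T \<in> E)"

definition star_endomorphisms ::
  "('h::complex_hilbert_space \<Rightarrow>\<^sub>L 'h) set \<Rightarrow> (('h \<Rightarrow>\<^sub>L 'h) \<Rightarrow> ('h \<Rightarrow>\<^sub>L 'h)) set" where
  "star_endomorphisms A =
    {\<Phi> \<in> A \<rightarrow>\<^sub>E A. clinear_on A \<Phi> \<and>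
      (\<forall>a\<in>A. \<forall>b\<in>A. \<Phi> (a o\<^sub>L b) = \<Phi> a o\<^sub>L \<Phi> b) \<and> (\<forall>a\<in>A. \<Phi> (adj a) = adj (\<Phi> a))}"

text \<open>Automorphisms are not assumed bounded; on a standard \<open>C\<^sup>*\<close>-algebra they automatically are.\<close>

definition automorphism_group ::
  "('h::complex_hilbert_space \<Rightarrow>\<^sub>L 'h) set \<Rightarrow> (('h \<Rightarrow>\<^sub>L 'h) \<Rightarrow> ('h \<Rightarrow>\<^sub>L 'h)) set" where
  "automorphism_group A =
    {\<Phi> \<in> A \<rightarrow>\<^sub>E A. clinear_on A \<Phi> \<and>
      (\<forall>a\<in>A. \<forall>b\<in>A. \<Phi> (a o\<^sub>L b) = \<Phi> a o\<^sub>L \<Phi> b) \<and> bij_betw \<Phi> A A}"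

definition star_automorphisms ::
  "('h::complex_hilbert_space \<Rightarrow>\<^sub>L 'h) set \<Rightarrow> (('h \<Rightarrow>\<^sub>L 'h) \<Rightarrow> ('h \<Rightarrow>\<^sub>L 'h)) set" where
  "star_automorphisms A = {\<Phi> \<in> automorphism_group A. \<forall>a\<in>A. \<Phi> (adj a) = adj (\<Phi> a)}"

definition isometry_group :: "'x::complex_normed_vector set \<Rightarrow> ('x \<Rightarrow> 'x) set" where
  "isometry_group X =
    {T \<in> X \<rightarrow>\<^sub>E X. clinear_on X T \<and> (\<forall>x\<in>X. norm (T x) = norm x) \<and> T ` X = X}"

end

theory Submission
  imports Defs
begin

text \<open>
  Let \<open>\<phi> T\<close> be the identity function \<open>z\<close>.  There is an orthonormal sequence \<open>e\<close> with
  \<open>\<parallel>T e\<^sub>n - e\<^sub>n\<parallel> \<le> 2\<^sup>-\<^sup>n\<close> and \<open>\<parallel>T\<^sup>* e\<^sub>n - e\<^sub>n\<parallel> \<le> 2\<^sup>-\<^sup>n\<close> that is eventually orthogonal to each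
  member of a dense sequence.  The unitary \<open>W\<^sub>n\<close> exchanging \<open>e\<^sub>n\<close> and \<open>e\<^sub>n\<^sub>+\<^sub>1\<close> is a finite rank
  perturbation of the identity, so it normalises \<open>A\<close>, and the automorphisms
  \<open>Ad (W\<^sub>0 \<cdots> W\<^sub>n\<^sub>-\<^sub>1)\<close> converge pointwise on \<open>T\<close> (as \<open>\<parallel>[W\<^sub>n, T]\<parallel>\<close> is summable) and on the operators of
  rank one; as they are isometric, they converge on the \<open>C\<^sup>*\<close>-algebra these generate, which is \<open>A\<close>.
  All of them carry some projection \<open>e\<^sub>n e\<^sub>n\<^sup>*\<close> to \<open>e\<^sub>0 e\<^sub>0\<^sup>*\<close>, and \<open>e\<^sub>n e\<^sub>n\<^sup>*\<close> does not converge, so that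
  \<open>e\<^sub>0 e\<^sub>0\<^sup>*\<close> is not in the range of the limit.
\<close>

section \<open>Hilbert space preliminaries\<close>

lemma cinner_add_right: "cinner x (y + z) = cinner x y + cinner x z"
  by (metis cinner_add_left cinner_commute complex_cnj_add)

lemma cinner_scaleC_right: "cinner x (c *\<^sub>C y) = cnj c * cinner x y"
  by (metis cinner_scaleC_left cinner_commute complex_cnj_mult)

lemma scaleR_eq_scaleC: "r *\<^sub>R x = complex_of_real r *\<^sub>C x"
  by (simp add: scaleC_of_real)

lemma cinner_zero_left [simp]: "cinner 0 y = 0"
  using cinner_add_left[of 0 0 y] by simp

lemma cinner_self_Re: "Re (cinner x x) = (norm x)\<^sup>2"
  by (simp add: cinner_self)

lemma norm_add_sq: "(norm (x + y))\<^sup>2 = (norm x)\<^sup>2 + (norm y)\<^sup>2 + 2 * Re (cinner x y)"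
proof -
  have "Re (cinner y x) = Re (cinner x y)"
    by (metis cinner_commute complex_cnj(1) complex.sel(1) cnj.simps(1))
  then have "Re (cinner (x + y) (x + y)) = (norm x)\<^sup>2 + (norm y)\<^sup>2 + 2 * Re (cinner x y)"
    by (simp add: cinner_add_left cinner_add_right cinner_self_Re[symmetric])
  then show ?thesis by (simp add: cinner_self_Re)
qed

text \<open>The norm is primitive here, so the Cauchy-Schwarz inequality is read off from the square
  of the triangle inequality.\<close>

lemma Re_cinner_le: "Re (cinner x y) \<le> norm x * norm y"
proof -
  have "(norm (x + y))\<^sup>2 \<le> (norm x + norm y)\<^sup>2"
    by (intro power_mono norm_triangle_ineq) simp
  then show ?thesis by (simp add: norm_add_sq power2_sum)
qed

lemma norm_cinner_le: "cmod (cinner x y) \<le> norm x * norm y"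
proof -
  \<comment> \<open>A unimodular factor turns the inner product into its modulus, so that the bound
    on real parts applies.\<close>
  obtain u where u: "cmod u = 1" "u * cinner x y = complex_of_real (cmod (cinner x y))"
  proof (cases "cinner x y = 0")
    case False
    let ?u = "complex_of_real (cmod (cinner x y)) / cinner x y"
    show ?thesis using False by (intro that[of ?u]) (auto simp: norm_divide)
  qed (use that[of 1] in auto)
  have "cmod (cinner x y) = Re (cinner (u *\<^sub>C x) y)"
    by (simp add: cinner_scaleC_left u)
  also have "\<dots> \<le> norm x * norm y"
    using Re_cinner_le[of "u *\<^sub>C x" y] by (simp add: norm_scaleC u)
  finally show ?thesis .
qed

interpretation cinner: bounded_bilinear "cinner :: 'h::complex_hilbert_space \<Rightarrow> 'h \<Rightarrow> complex"
proof
  show "\<exists>K. \<forall>a b. norm (cinner a b :: complex) \<le> norm (a::'h) * norm b * K"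
    by (rule exI[of _ 1]) (simp add: norm_cinner_le)
qed (simp_all add: cinner_add_left cinner_add_right scaleR_eq_scaleC cinner_scaleC_left
      cinner_scaleC_right scaleR_conv_of_real)

declare cinner.zero_right [simp]

lemma orthogonal_sym: "cinner x y = 0 \<longleftrightarrow> cinner y x = 0"
  by (metis cinner_commute complex_cnj_zero)

lemma norm_diff_sq: "(norm (x - y))\<^sup>2 = (norm x)\<^sup>2 + (norm y)\<^sup>2 - 2 * Re (cinner x y)"
  using norm_add_sq[of x "- y"] by (simp add: cinner.minus_right)

lemma cinner_ext:
  assumes "\<And>x. cinner x y = cinner x z" shows "y = z"
proof -
  have "cinner (y - z) (y - z) = 0"
    by (simp add: cinner.diff_right assms)
  then show ?thesis by (simp add: cinner_self)
qed

text \<open>If \<open>s\<close> represents \<open>f\<close>, then \<open>J x\<close> below is the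
  squared norm of \<open>x - s\<close> minus that of \<open>s\<close>. So a minimiser of
  \<open>J\<close> is found as the limit of a minimising sequence, and its first variation
  identifies it as the representing vector.\<close>

lemma riesz_representation:
  fixes f :: "'h::complex_hilbert_space \<Rightarrow> complex"
  assumes f: "bounded_linear f" and fC: "\<And>c x. f (c *\<^sub>C x) = c * f x"
  shows "\<exists>s. \<forall>x. f x = cinner x s"
proof -
  interpret f: bounded_linear f by fact
  define J where "J x = (norm x)\<^sup>2 - 2 * Re (f x)" for x
  obtain M where M: "\<And>x. norm (f x) \<le> norm x * M" using f.bounded by blast
  have bd: "- M\<^sup>2 \<le> J x" for x
  proof -
    have "Re (f x) \<le> norm x * M" using M[of x] complex_Re_le_cmod[of "f x"] by linarith
    moreover have "0 \<le> (norm x - M)\<^sup>2" by simp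
    ultimately show ?thesis by (simp add: J_def power2_diff)
  qed
  define m where "m = Inf (range J)"
  have bb: "bdd_below (range J)" using bd by (intro bdd_belowI2) auto
  have mJ: "m \<le> J x" for x unfolding m_def by (intro cInf_lower bb) auto
  have "\<exists>x. J x < m + 1 / real (Suc n)" for n
    using cInf_lessD[of "range J" "m + 1 / real (Suc n)"] by (auto simp: m_def)
  then obtain X where X: "\<And>n. J (X n) < m + 1 / real (Suc n)" by metis
  \<comment> \<open>Parallelogram law: the midpoint \<open>?z\<close> also satisfies
    \<open>m \<le> J ?z\<close>, so two near-minimisers are close to each other.\<close>
  have par: "(norm (x - y))\<^sup>2 \<le> 2 * (J x - m) + 2 * (J y - m)" for x y
  proof -
    let ?z = "(1/2) *\<^sub>R (x + y)"
    have lin: "a + b - 2 * c = 2 * (a - 2 * p) + 2 * (b - 2 * q) - 4 * ((a + b + 2 * c) / 4 - p - q)"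
      for a b c p q :: real by (simp add: field_simps)
    have Jz: "J ?z = (norm (x + y))\<^sup>2 / 4 - Re (f x) - Re (f y)"
      by (simp add: J_def f.scaleR f.add power_divide add_divide_distrib)
    have "(norm (x - y))\<^sup>2 = 2 * J x + 2 * J y - 4 * J ?z"
      unfolding Jz unfolding norm_add_sq norm_diff_sq J_def by (rule lin)
    with mJ[of ?z] show ?thesis by simp
  qed
  have "Cauchy X"
  proof (rule metric_CauchyI)
    fix e :: real assume "0 < e"
    then obtain N where N: "4 / e\<^sup>2 < real N" using reals_Archimedean2 by blast
    then have N0: "0 < real N" using \<open>0 < e\<close> by (smt (verit) divide_pos_pos zero_less_power)
    have lt: "J (X n) - m < e\<^sup>2 / 4" if "n \<ge> N" for n
    proof -
      have "1 / real (Suc n) \<le> 1 / real N" using that N0 by (simp add: frac_le)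
      also have "\<dots> < e\<^sup>2 / 4" using N N0 \<open>0 < e\<close> by (simp add: field_simps)
      finally show ?thesis using X[of n] by simp
    qed
    show "\<exists>M. \<forall>m\<ge>M. \<forall>n\<ge>M. dist (X m) (X n) < e"
    proof (intro exI allI impI)
      fix i j assume "i \<ge> N" "j \<ge> N"
      then have "(norm (X i - X j))\<^sup>2 < e\<^sup>2"
        using par[of "X i" "X j"] lt[of i] lt[of j] by simp
      then show "dist (X i) (X j) < e"
        using \<open>0 < e\<close> by (simp add: dist_norm power_less_imp_less_base)
    qed
  qed
  then obtain s where s: "X \<longlonglongrightarrow> s" using Cauchy_convergent convergentD by blast
  have "(\<lambda>n. J (X n)) \<longlonglongrightarrow> J s"
    unfolding J_def by (intro tendsto_intros f.tendsto s)
  moreover have "(\<lambda>n. m + 1 / real (Suc n)) \<longlonglongrightarrow> m + 0"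
    by (intro tendsto_intros LIMSEQ_Suc[OF lim_const_over_n, of 1])
  ultimately have "J s \<le> m"
    using LIMSEQ_le[of "\<lambda>n. J (X n)" "J s" "\<lambda>n. m + 1 / real (Suc n)" "m + 0"] X less_imp_le
    by (metis add.right_neutral)
  then have Js: "J s \<le> J x" for x using mJ[of x] by simp
  have Re: "Re (f x) = Re (cinner x s)" for x
  proof -
    define d where "d = Re (cinner x s) - Re (f x)"
    \<comment> \<open>\<open>J\<close> does not drop below \<open>J s\<close> along the line through
      \<open>s\<close> in direction \<open>x\<close>, which forces the linear coefficient
      \<open>d\<close> to vanish.\<close>
    have quad: "0 \<le> t\<^sup>2 * (norm x)\<^sup>2 + 2 * t * d" for t :: real
    proof -
      have "Re (cinner s (t *\<^sub>R x)) = t * Re (cinner x s)"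
        using cinner_commute[of s x] by (simp add: cinner.scaleR_right)
      then have "J (s + t *\<^sub>R x) = J s + t\<^sup>2 * (norm x)\<^sup>2 + 2 * t * d"
        by (simp add: J_def norm_add_sq f.add f.scaleR d_def power_mult_distrib algebra_simps)
      with Js[of "s + t *\<^sub>R x"] show ?thesis by simp
    qed
    have "d = 0"
    proof (rule ccontr)
      assume d: "d \<noteq> 0"
      \<comment> \<open>The summand 1 keeps the denominator positive for \<open>x = 0\<close>. With
        this \<open>t\<close> the quadratic equals \<open>t * d - t\<^sup>2\<close>, which is
        negative.\<close>
      define t where "t = - d / ((norm x)\<^sup>2 + 1)"
      have p: "(norm x)\<^sup>2 + 1 > 0" by (smt (verit) zero_le_power2)
      have "t\<^sup>2 * (norm x)\<^sup>2 + 2 * t * d = t\<^sup>2 * ((norm x)\<^sup>2 + 1) - t\<^sup>2 + 2 * t * d"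
        by (simp add: algebra_simps)
      also have "t\<^sup>2 * ((norm x)\<^sup>2 + 1) = - t * d"
        using p by (simp add: t_def power2_eq_square)
      finally have "t\<^sup>2 * (norm x)\<^sup>2 + 2 * t * d = t * d - t\<^sup>2" by simp
      moreover have "t * d < 0"
        using p d by (simp add: t_def divide_neg_pos not_square_less_zero power2_eq_square[symmetric])
      ultimately show False using quad[of t] by (smt (verit) zero_le_power2)
    qed
    then show ?thesis by (simp add: d_def)
  qed
  have "f x = cinner x s" for x
  proof (rule complex_eqI)
    show "Re (f x) = Re (cinner x s)" by (rule Re)
    \<comment> \<open>Multiplying \<open>x\<close> by the imaginary unit turns imaginary parts into
      real parts, up to a sign.\<close>
    show "Im (f x) = Im (cinner x s)"
      using Re[of "\<i> *\<^sub>C x"] by (simp add: fC cinner_scaleC_left)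
  qed
  then show ?thesis by blast
qed

section \<open>Adjoints and operators of rank one\<close>

lemma cbounded_opsD: "T \<in> cbounded_ops \<Longrightarrow> blinfun_apply T (c *\<^sub>C x) = c *\<^sub>C blinfun_apply T x"
  by (simp add: cbounded_ops_def)

lemma adj_unique:
  assumes "\<And>x y. cinner (blinfun_apply T x) y = cinner x (blinfun_apply S y)"
  shows "adj T = S"
  unfolding adj_def
proof (rule the_equality)
  fix R assume "\<forall>x y. cinner (blinfun_apply T x) y = cinner x (blinfun_apply R y)"
  with assms show "R = S" by (intro blinfun_eqI cinner_ext) metis
qed (use assms in blast)

text \<open>For fixed \<open>y\<close>, the Riesz vector of the functional sending \<open>x\<close>
  to \<open>cinner (T x) y\<close> is \<open>g y\<close>. Its uniqueness makes \<open>g\<close>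
  real-linear, and testing at \<open>g y\<close> bounds \<open>g\<close> by the norm of
  \<open>T\<close>.\<close>

lemma adj_exists:
  fixes T :: "'h::complex_hilbert_space \<Rightarrow>\<^sub>L 'h"
  assumes "T \<in> cbounded_ops"
  shows "\<exists>S. \<forall>x y. cinner (blinfun_apply T x) y = cinner x (blinfun_apply S y)"
proof -
  have "\<exists>s. \<forall>x. cinner (blinfun_apply T x) y = cinner x s" for y
    by (rule riesz_representation)
      (auto intro!: bounded_linear_intros cinner.bounded_linear_left[THEN bounded_linear_compose]
        simp: cbounded_opsD[OF assms] cinner_scaleC_left)
  then obtain g where g: "\<And>x y. cinner (blinfun_apply T x) y = cinner x (g y)" by metis
  have "bounded_linear g"
  proof (rule bounded_linear_intro)
    show "g (x + y) = g x + g y" for x y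
      by (rule cinner_ext) (simp add: g[symmetric] cinner.add_right)
    show "g (r *\<^sub>R x) = r *\<^sub>R g x" for r x
      by (rule cinner_ext) (simp add: g[symmetric] cinner.scaleR_right)
    show "norm (g y) \<le> norm y * norm T" for y
    proof -
      have "(norm (g y))\<^sup>2 = Re (cinner (blinfun_apply T (g y)) y)"
        by (simp add: g cinner_self)
      also have "\<dots> \<le> norm (blinfun_apply T (g y)) * norm y" by (rule Re_cinner_le)
      also have "\<dots> \<le> (norm T * norm (g y)) * norm y"
        by (intro mult_right_mono norm_blinfun) simp
      finally have "norm (g y) * norm (g y) \<le> (norm y * norm T) * norm (g y)"
        by (simp add: power2_eq_square algebra_simps)
      then show ?thesis
        by (cases "norm (g y) = 0") auto
    qed
  qed
  then show ?thesis
    by (intro exI[of _ "Blinfun g"]) (simp add: bounded_linear_Blinfun_apply g)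
qed

lemma cinner_adj:
  assumes "T \<in> cbounded_ops"
  shows "cinner (blinfun_apply T x) y = cinner x (blinfun_apply (adj T) y)"
  using adj_exists[OF assms] adj_unique by metis

lemma cinner_adj':
  assumes "T \<in> cbounded_ops"
  shows "cinner (blinfun_apply (adj T) x) y = cinner x (blinfun_apply T y)"
  by (metis cinner_adj[OF assms] cinner_commute)

lemma norm_adj_le:
  assumes "T \<in> cbounded_ops"
  shows "norm (adj T) \<le> norm T"
proof (rule norm_blinfun_bound)
  fix y
  let ?z = "blinfun_apply (adj T) y"
  have "(norm ?z)\<^sup>2 = Re (cinner (blinfun_apply T ?z) y)"
    by (simp add: cinner_adj[OF assms] cinner_self)
  also have "\<dots> \<le> norm (blinfun_apply T ?z) * norm y" by (rule Re_cinner_le)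
  also have "\<dots> \<le> (norm T * norm ?z) * norm y"
    by (intro mult_right_mono norm_blinfun) simp
  finally have "norm ?z * norm ?z \<le> (norm T * norm y) * norm ?z"
    by (simp add: power2_eq_square algebra_simps)
  then show "norm ?z \<le> norm T * norm y"
    by (cases "norm ?z = 0") auto
qed simp

lemma adj_diff:
  assumes "S \<in> cbounded_ops" "T \<in> cbounded_ops"
  shows "adj (S - T) = adj S - adj T"
  by (rule adj_unique)
    (simp add: blinfun.diff_left cinner.diff_left cinner.diff_right cinner_adj assms)

lift_definition rank1 :: "'h::complex_hilbert_space \<Rightarrow> 'h \<Rightarrow> ('h \<Rightarrow>\<^sub>L 'h)"
  is "\<lambda>x y z. cinner z y *\<^sub>C x"
proof (rule bounded_linear_intro)
  fix x y :: 'h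
  show "cinner (a + b) y *\<^sub>C x = cinner a y *\<^sub>C x + cinner b y *\<^sub>C x" for a b
    by (simp add: cinner_add_left scaleC_add_left)
  show "cinner (r *\<^sub>R a) y *\<^sub>C x = r *\<^sub>R (cinner a y *\<^sub>C x)" for r a
    by (simp add: scaleR_eq_scaleC cinner_scaleC_left scaleC_scaleC)
  show "norm (cinner z y *\<^sub>C x) \<le> norm z * (norm y * norm x)" for z
    using mult_right_mono[OF norm_cinner_le[of z y], of "norm x"] by (simp add: norm_scaleC mult.assoc)
qed

lemma rank1_apply [simp]: "blinfun_apply (rank1 x y) z = cinner z y *\<^sub>C x"
  by transfer simp

lemma norm_rank1_le: "norm (rank1 x y) \<le> norm x * norm y"
proof (rule norm_blinfun_bound)
  show "norm (blinfun_apply (rank1 x y) z) \<le> norm x * norm y * norm z" for z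
    using mult_right_mono[OF norm_cinner_le[of z y], of "norm x"] by (simp add: norm_scaleC algebra_simps)
qed simp

lemma rank1_add_left: "rank1 (x + x') y = rank1 x y + rank1 x' y"
  by (rule blinfun_eqI) (simp add: blinfun.add_left scaleC_add_right)

lemma rank1_add_right: "rank1 x (y + y') = rank1 x y + rank1 x y'"
  by (rule blinfun_eqI) (simp add: blinfun.add_left scaleC_add_left cinner_add_right)

interpretation rank1: bounded_bilinear "rank1 :: 'h::complex_hilbert_space \<Rightarrow> _"
proof
  show "rank1 (r *\<^sub>R x) y = r *\<^sub>R rank1 x y" for r and x y :: 'h
    by (rule blinfun_eqI)
      (simp only: rank1_apply blinfun.scaleR_left, simp add: scaleR_eq_scaleC scaleC_scaleC mult.commute)
  show "rank1 x (r *\<^sub>R y) = r *\<^sub>R rank1 x y" for r and x y :: 'h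
    by (rule blinfun_eqI)
      (simp only: rank1_apply blinfun.scaleR_left,
        simp add: scaleR_eq_scaleC cinner_scaleC_right scaleC_scaleC)
  show "\<exists>K. \<forall>a b. norm (rank1 a b) \<le> norm (a::'h) * norm b * K"
    by (rule exI[of _ 1]) (simp add: norm_rank1_le)
qed (fact rank1_add_left rank1_add_right)+

lemma rank1_cbounded: "rank1 x y \<in> cbounded_ops"
  by (simp add: cbounded_ops_def cinner_scaleC_left scaleC_scaleC)

lemma rank1_finite_rank: "rank1 x y \<in> finite_rank_ops"
proof -
  have "range (blinfun_apply (rank1 x y)) \<subseteq> cvec.span {x}"
    by (auto intro: cvec.span_scale cvec.span_base)
  then show ?thesis
    unfolding finite_rank_ops_def by (intro CollectI conjI rank1_cbounded exI[of _ "{x}"]) auto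
qed

text \<open>The unit ball is mapped into the multiples of \<open>x\<close> by scalars of modulus at
  most \<open>norm y\<close>, a continuous image of a compact disc.\<close>

lemma rank1_compact: "rank1 x y \<in> compact_ops"
proof -
  let ?K = "(\<lambda>c. c *\<^sub>C x) ` cball 0 (norm y)"
  have "continuous_on UNIV (\<lambda>c. c *\<^sub>C x)"
  proof (rule bounded_linear.continuous_on[OF bounded_linear_intro continuous_on_id])
    show "norm (c *\<^sub>C x) \<le> norm c * norm x" for c by (simp add: norm_scaleC)
  qed (simp_all add: scaleC_add_left scaleR_conv_of_real scaleR_eq_scaleC scaleC_scaleC)
  then have K: "compact ?K"
    by (intro compact_continuous_image compact_cball) (auto intro: continuous_on_subset)
  have "cmod (cinner z y) \<le> norm y" if "norm z \<le> 1" for z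
    using norm_cinner_le[of z y] mult_right_mono[OF that, of "norm y"] by simp
  then have "blinfun_apply (rank1 x y) ` cball 0 1 \<subseteq> ?K"
    by (intro image_subsetI) (auto intro: imageI)
  then have "closure (blinfun_apply (rank1 x y) ` cball 0 1) \<subseteq> ?K"
    by (rule closure_minimal) (simp add: K compact_imp_closed)
  then have "compact (closure (blinfun_apply (rank1 x y) ` cball 0 1))"
    using compact_Int_closed[OF K closed_closure] by (metis Int_absorb1)
  then show ?thesis by (simp add: compact_ops_def rank1_cbounded)
qed

text \<open>The orthogonal projection onto the span of \<open>F\<close>, by Gram-Schmidt.\<close>

lemma finite_rank_projection:
  fixes F :: "'h::complex_hilbert_space set"
  assumes "finite F"
  obtains I :: "'h set" where "finite I"
    "\<And>f. f \<in> F \<Longrightarrow> blinfun_apply (\<Sum>u\<in>I. rank1 u u) f = f"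
    "\<And>x f. f \<in> F \<Longrightarrow> cinner (x - blinfun_apply (\<Sum>u\<in>I. rank1 u u) x) f = 0"
    "\<And>x. norm (x - blinfun_apply (\<Sum>u\<in>I. rank1 u u) x) \<le> norm x"
proof -
  define Q where "Q I = (\<lambda>x. \<Sum>u\<in>I. cinner x u *\<^sub>C u)" for I :: "'h set"
  have Q: "blinfun_apply (\<Sum>u\<in>I. rank1 u u) x = Q I x" for I x
    by (simp add: Q_def blinfun.sum_left)
  have sa: "cinner (Q I x) y = cinner x (Q I y)" for I x y
    by (simp add: Q_def cinner.sum_left cinner.sum_right cinner_scaleC_left cinner_scaleC_right
        cinner_commute[symmetric] mult.commute)
  have Qd: "Q I (x - y) = Q I x - Q I y" for I x y
    by (simp add: Q[symmetric] blinfun.diff_right)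
  have Qa: "Q I (x + y) = Q I x + Q I y" for I x y
    by (simp add: Q[symmetric] blinfun.add_right)
  have Qsc: "Q I (c *\<^sub>C x) = c *\<^sub>C Q I x" for I c x
    by (simp add: Q_def cinner_scaleC_left cvec.scale_sum_right)
  \<comment> \<open>Besides fixing \<open>F\<close>, only idempotence is carried through the
    induction: \<open>Q I\<close> is self-adjoint for every \<open>I\<close>, and the two together
    make it an orthogonal projection.\<close>
  have "\<exists>I. finite I \<and> (\<forall>f\<in>F. Q I f = f) \<and> (\<forall>x. Q I (Q I x) = Q I x)"
    using assms
  proof induction
    case empty
    then show ?case by (intro exI[of _ "{}"]) (simp add: Q_def)
  next
    case (insert z F)
    then obtain I where I: "finite I" "\<And>f. f \<in> F \<Longrightarrow> Q I f = f" "\<And>x. Q I (Q I x) = Q I x" by blast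
    define r where "r = z - Q I z"
    show ?case
    proof (cases "r = 0")
      case True
      then show ?thesis using I by (intro exI[of _ I]) (auto simp: r_def)
    next
      case False
      define u where "u = inverse (complex_of_real (norm r)) *\<^sub>C r"
      have nu: "norm u = 1" using False by (simp add: u_def norm_scaleC norm_inverse)
      have ru: "r = complex_of_real (norm r) *\<^sub>C u" using False by (simp add: u_def)
      have Qr: "Q I r = 0" by (simp add: r_def Qd I)
      have Qu: "Q I u = 0"
        by (simp add: u_def Qsc Qr)
      \<comment> \<open>\<open>I\<close> is a set, so the new vector must be fresh for the sum to
        gain a term. If \<open>u\<close> were in \<open>I\<close>, then \<open>Q I u = 0\<close>
        would make every coefficient of \<open>u\<close> vanish, including
        \<open>cinner u u\<close>.\<close>
      have uI: "u \<notin> I"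
      proof
        assume "u \<in> I"
        have "complex_of_real (\<Sum>v\<in>I. (cmod (cinner u v))\<^sup>2) = cinner u (Q I u)"
          unfolding of_real_sum complex_norm_square Q_def cinner.sum_right cinner_scaleC_right
          by (rule sum.cong[OF refl mult.commute])
        also have "\<dots> = 0" unfolding Qu by (rule cinner.zero_right)
        finally have "(\<Sum>v\<in>I. (cmod (cinner u v))\<^sup>2) = 0" by (rule of_real_eq_0_iff[THEN iffD1])
        then have "cmod (cinner u u) = 0"
          using \<open>u \<in> I\<close> I(1) by (simp add: sum_nonneg_eq_0_iff)
        then show False using nu by (simp add: cinner_self)
      qed
      have Q': "Q (insert u I) x = cinner x u *\<^sub>C u + Q I x" for x
        using uI I(1) by (simp add: Q_def)
      have Qxu: "cinner (Q I x) u = 0" for x by (simp add: sa Qu)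
      have uu: "cinner u u = 1" using nu by (simp add: cinner_self)
      have "cinner z u = cinner r u" by (simp add: r_def cinner.diff_left Qxu)
      also have "\<dots> = cinner (complex_of_real (norm r) *\<^sub>C u) u"
        using ru by (rule arg_cong)
      also have "\<dots> = complex_of_real (norm r)"
        by (simp add: cinner_scaleC_left uu)
      finally have "Q (insert u I) z = complex_of_real (norm r) *\<^sub>C u + Q I z"
        by (simp only: Q')
      also have "\<dots> = r + Q I z" by (simp only: ru[symmetric])
      finally have "Q (insert u I) z = z" by (simp add: r_def)
      moreover have "Q (insert u I) f = f" if "f \<in> F" for f
        using I(2)[OF that] Qxu[of f] by (simp add: Q')
      moreover have "Q (insert u I) (Q (insert u I) x) = Q (insert u I) x" for x
      proof -
        have "Q I (cinner x u *\<^sub>C u + Q I x) = Q I x"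
          by (simp add: Qa Qsc Qu I)
        then show ?thesis
          by (simp add: Q' cinner_add_left cinner_scaleC_left uu Qxu)
      qed
      ultimately show ?thesis using I(1) by (intro exI[of _ "insert u I"]) auto
    qed
  qed
  then obtain I where I: "finite I" "\<And>f. f \<in> F \<Longrightarrow> Q I f = f" "\<And>x. Q I (Q I x) = Q I x" by blast
  show thesis
  proof (rule that[OF I(1)])
    show "blinfun_apply (\<Sum>u\<in>I. rank1 u u) f = f" if "f \<in> F" for f
      using that I Q by simp
    show "cinner (x - blinfun_apply (\<Sum>u\<in>I. rank1 u u) x) f = 0" if "f \<in> F" for f x
      using that I by (simp add: Q cinner.diff_left sa)
    show "norm (x - blinfun_apply (\<Sum>u\<in>I. rank1 u u) x) \<le> norm x" for x
    proof -
      have "cinner x (Q I x) = cinner (Q I x) (Q I x)" by (simp only: sa I(3))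
      then have "(norm (x - Q I x))\<^sup>2 = (norm x)\<^sup>2 - (norm (Q I x))\<^sup>2"
        by (simp add: norm_diff_sq cinner_self)
      then have "(norm (x - Q I x))\<^sup>2 \<le> (norm x)\<^sup>2" by simp
      then show ?thesis unfolding Q by (rule power2_le_imp_le) simp
    qed
  qed
qed

section \<open>Extensions of the compact operators by the circle\<close>

locale circle_extension =
  fixes A :: "('h::complex_hilbert_space \<Rightarrow>\<^sub>L 'h) set"
    and \<phi> :: "('h \<Rightarrow>\<^sub>L 'h) \<Rightarrow> complex \<Rightarrow> complex"
  assumes extension: "is_extension A \<phi>"
begin

section \<open>Algebraic rules for \<open>A\<close> and for the symbol map
  \<open>\<phi>\<close>\<close>

lemma A_cstar: "cstar_subalgebra A"
  using extension by (simp add: is_extension_def standard_cstar_algebra_def)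

lemma A_subspace: "cvec.subspace A"
  and A_cbounded: "a \<in> A \<Longrightarrow> a \<in> cbounded_ops"
  and A_comp: "a \<in> A \<Longrightarrow> b \<in> A \<Longrightarrow> a o\<^sub>L b \<in> A"
  and A_adj: "a \<in> A \<Longrightarrow> adj a \<in> A"
  and A_closed: "closed A"
  using A_cstar by (auto simp: cstar_subalgebra_def)

lemmas A_add = cvec.subspace_add[OF A_subspace]
  and A_diff = cvec.subspace_diff[OF A_subspace]
  and A_scale = cvec.subspace_scale[OF A_subspace]
  and A_zero = cvec.subspace_0[OF A_subspace]
  and A_sum = cvec.subspace_sum[OF A_subspace]

lemma rank1_A: "rank1 x y \<in> A"
  using extension rank1_finite_rank by (auto simp: is_extension_def standard_cstar_algebra_def)

lemma \<phi>_add: "a \<in> A \<Longrightarrow> b \<in> A \<Longrightarrow> z \<in> unit_circle \<Longrightarrow> \<phi> (a + b) z = \<phi> a z + \<phi> b z"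
  and \<phi>_scale: "a \<in> A \<Longrightarrow> z \<in> unit_circle \<Longrightarrow> \<phi> (c *\<^sub>C a) z = c * \<phi> a z"
  and \<phi>_comp: "a \<in> A \<Longrightarrow> b \<in> A \<Longrightarrow> z \<in> unit_circle \<Longrightarrow> \<phi> (a o\<^sub>L b) z = \<phi> a z * \<phi> b z"
  and \<phi>_adj: "a \<in> A \<Longrightarrow> z \<in> unit_circle \<Longrightarrow> \<phi> (adj a) z = cnj (\<phi> a z)"
  and \<phi>_kernel: "{a \<in> A. \<forall>z\<in>unit_circle. \<phi> a z = 0} = compact_ops"
  and \<phi>_range: "\<phi> ` A = C_circle"
  using extension unfolding is_extension_def by blast+

lemma \<phi>_diff:
  assumes "a \<in> A" "b \<in> A" "z \<in> unit_circle"
  shows "\<phi> (a - b) z = \<phi> a z - \<phi> b z"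
  using \<phi>_add[of "a - b" b z] assms by (simp add: A_diff)

lemma \<phi>_sum:
  assumes "\<And>i. i \<in> I \<Longrightarrow> f i \<in> A" "z \<in> unit_circle"
  shows "\<phi> (\<Sum>i\<in>I. f i) z = (\<Sum>i\<in>I. \<phi> (f i) z)"
  using assms(1)
proof (induction I rule: infinite_finite_induct)
  case (insert i I)
  then show ?case using assms(2) by (simp add: \<phi>_add A_sum)
qed (use \<phi>_scale[OF A_zero assms(2), of 0] in simp_all)

lemma \<phi>_rank1: "z \<in> unit_circle \<Longrightarrow> \<phi> (rank1 x y) z = 0"
  using \<phi>_kernel rank1_compact[of x y] by blast

lemma lift_exists:
  assumes "continuous_on unit_circle g"
  obtains a where "a \<in> A" "\<And>z. z \<in> unit_circle \<Longrightarrow> \<phi> a z = g z"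
proof -
  have "restrict g unit_circle \<in> C_circle"
    using assms continuous_on_cong[of unit_circle unit_circle "restrict g unit_circle" g]
    by (simp add: C_circle_def del: mem_sphere_0)
  then obtain a where "a \<in> A" "\<phi> a = restrict g unit_circle"
    using \<phi>_range by (metis imageE)
  then show thesis using that by simp
qed

lemma \<phi>_continuous: "a \<in> A \<Longrightarrow> continuous_on unit_circle (\<phi> a)"
  using \<phi>_range by (auto simp: C_circle_def)

text \<open>
  If \<open>\<phi> c z = 1\<close> and \<open>\<parallel>c\<parallel> < 1\<close>, the fixed point \<open>d = c + c d\<close> of a contraction of \<open>A\<close> would give
  \<open>\<phi> d z = 1 + \<phi> d z\<close>.
\<close>

lemma norm_\<phi>_le:
  assumes a: "a \<in> A" and z: "z \<in> unit_circle"
  shows "cmod (\<phi> a z) \<le> norm a"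
proof (rule ccontr)
  assume "\<not> ?thesis"
  then have lt: "norm a < cmod (\<phi> a z)" by simp
  then have nz: "\<phi> a z \<noteq> 0" using norm_ge_zero[of a] by auto
  define c where "c = inverse (\<phi> a z) *\<^sub>C a"
  have c: "c \<in> A" "\<phi> c z = 1" "norm c < 1"
    using a z nz lt by (simp_all add: c_def A_scale \<phi>_scale norm_scaleC norm_inverse
        inverse_eq_divide norm_divide)
  have "\<exists>!d\<in>A. c + (c o\<^sub>L d) = d"
  proof (rule Banach_fix)
    show "complete A" using A_closed by (simp add: complete_eq_closed)
    show "A \<noteq> {}" using a by auto
    show "(\<lambda>d. c + (c o\<^sub>L d)) ` A \<subseteq> A" using c by (auto intro: A_add A_comp)
    show "dist (c + (c o\<^sub>L x)) (c + (c o\<^sub>L y)) \<le> norm c * dist x y" for x y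
    proof -
      have "(c + (c o\<^sub>L x)) - (c + (c o\<^sub>L y)) = c o\<^sub>L (x - y)"
        by (rule blinfun_eqI) (simp add: blinfun.bilinear_simps)
      then show ?thesis by (simp only: dist_norm norm_blinfun_compose)
    qed
  qed (use c in auto)
  then obtain d where d: "d \<in> A" "c + (c o\<^sub>L d) = d" by blast
  then have "\<phi> d z = \<phi> (c + (c o\<^sub>L d)) z" by simp
  also have "\<dots> = 1 + \<phi> d z" using c(1,2) d(1) z by (simp add: \<phi>_add \<phi>_comp A_comp)
  finally show False by simp
qed

text \<open>
  Writing \<open>1 - |\<phi> a|\<^sup>2 / \<epsilon>\<^sup>2 = |\<phi> d|\<^sup>2\<close>, the operator \<open>k = \<epsilon>\<^sup>2 u\<^sup>*u - a\<^sup>*a - \<epsilon>\<^sup>2 d\<^sup>*d\<close> is compact.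
  Vectors \<open>x\<close> orthogonal to a finite \<open>\<epsilon>\<^sup>2\<close>-net of the image of the ball under \<open>k\<close> satisfy
  \<open>|\<langle>k x, x\<rangle>| \<le> \<epsilon>\<^sup>2 \<parallel>x\<parallel>\<^sup>2\<close>.
\<close>

lemma small_on_finite_codimension:
  assumes a: "a \<in> A" and \<epsilon>: "0 < \<epsilon>" and le: "\<And>z. z \<in> unit_circle \<Longrightarrow> cmod (\<phi> a z) \<le> \<epsilon>"
    and u: "u \<in> A" "\<And>z. z \<in> unit_circle \<Longrightarrow> \<phi> u z = 1"
  shows "\<exists>F. finite F \<and> (\<forall>x. (\<forall>f\<in>F. cinner x f = 0) \<longrightarrow>
    norm (blinfun_apply a x) \<le> \<epsilon> * (norm u + 1) * norm x)"
proof -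
  have "continuous_on unit_circle (\<lambda>z. complex_of_real (sqrt (1 - (cmod (\<phi> a z) / \<epsilon>)\<^sup>2)))"
    using \<epsilon> by (intro continuous_intros \<phi>_continuous[OF a]) auto
  then obtain d where d: "d \<in> A"
    "\<And>z. z \<in> unit_circle \<Longrightarrow> \<phi> d z = complex_of_real (sqrt (1 - (cmod (\<phi> a z) / \<epsilon>)\<^sup>2))"
    using lift_exists by metis
  define k where "k = complex_of_real (\<epsilon>\<^sup>2) *\<^sub>C (adj u o\<^sub>L u) - (adj a o\<^sub>L a)
    - complex_of_real (\<epsilon>\<^sup>2) *\<^sub>C (adj d o\<^sub>L d)"
  note inA = a u(1) d(1) A_adj A_comp A_scale A_diff
  have "\<phi> k z = 0" if z: "z \<in> unit_circle" for z
  proof -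
    have 1: "cnj (\<phi> a z) * \<phi> a z = complex_of_real ((cmod (\<phi> a z))\<^sup>2)"
      by (simp only: complex_norm_square mult.commute)
    have "(cmod (\<phi> a z) / \<epsilon>)\<^sup>2 \<le> 1"
      using le[OF z] \<epsilon> by (simp add: power_le_one)
    then have "(sqrt (1 - (cmod (\<phi> a z) / \<epsilon>)\<^sup>2))\<^sup>2 = 1 - (cmod (\<phi> a z) / \<epsilon>)\<^sup>2" by simp
    then have 2: "cnj (\<phi> d z) * \<phi> d z = complex_of_real (1 - (cmod (\<phi> a z) / \<epsilon>)\<^sup>2)"
      by (simp only: d(2)[OF z] complex_cnj_complex_of_real of_real_mult[symmetric] power2_eq_square)
    have "\<phi> k z = complex_of_real (\<epsilon>\<^sup>2) * 1 - cnj (\<phi> a z) * \<phi> a z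
        - complex_of_real (\<epsilon>\<^sup>2) * (cnj (\<phi> d z) * \<phi> d z)"
      using inA z by (simp add: k_def \<phi>_diff \<phi>_scale \<phi>_comp \<phi>_adj u(2))
    also have "\<dots> = complex_of_real (\<epsilon>\<^sup>2 - (cmod (\<phi> a z))\<^sup>2 - \<epsilon>\<^sup>2 * (1 - (cmod (\<phi> a z) / \<epsilon>)\<^sup>2))"
      unfolding 1 2 by simp
    also have "\<dots> = 0" using \<epsilon> by (simp add: power_divide right_diff_distrib)
    finally show ?thesis .
  qed
  moreover have "k \<in> A" unfolding k_def by (intro inA)
  ultimately have "k \<in> compact_ops" using \<phi>_kernel by blast
  then have "compact (closure (blinfun_apply k ` cball 0 1))" by (simp add: compact_ops_def)
  then obtain F where F: "finite F" "closure (blinfun_apply k ` cball 0 1) \<subseteq> (\<Union>x\<in>F. ball x (\<epsilon>\<^sup>2))"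
    using compact_eq_totally_bounded[THEN iffD1, THEN conjunct2, rule_format, of _ "\<epsilon>\<^sup>2"] \<epsilon>
    by (metis zero_less_power)
  have unit: "norm (blinfun_apply a x) \<le> \<epsilon> * (norm u + 1)"
    if x: "\<And>f. f \<in> F \<Longrightarrow> cinner x f = 0" and nx: "norm x = 1" for x
  proof -
    have "blinfun_apply k x \<in> closure (blinfun_apply k ` cball 0 1)"
      using nx by (intro closure_subset[THEN subsetD]) auto
    then obtain f where f: "f \<in> F" "norm (f - blinfun_apply k x) < \<epsilon>\<^sup>2"
      using F(2) by (auto simp: dist_norm)
    have "\<bar>Re (cinner (blinfun_apply k x) x)\<bar> \<le> cmod (cinner (blinfun_apply k x - f) x)"
      using x[OF f(1)] orthogonal_sym[of x f] abs_Re_le_cmod by (simp add: cinner.diff_left)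
    also have "\<dots> \<le> \<epsilon>\<^sup>2"
      using norm_cinner_le[of "blinfun_apply k x - f" x] f(2) nx by (simp add: norm_minus_commute)
    finally have k1: "\<bar>Re (cinner (blinfun_apply k x) x)\<bar> \<le> \<epsilon>\<^sup>2" .
    have adj: "cinner (blinfun_apply (adj b) (blinfun_apply b x)) x
        = complex_of_real ((norm (blinfun_apply b x))\<^sup>2)" if "b \<in> A" for b
      by (simp add: cinner_adj'[OF A_cbounded[OF that]] cinner_self)
    have sc: "blinfun_apply (c *\<^sub>C S) y = c *\<^sub>C blinfun_apply S y" for c y and S :: "'h \<Rightarrow>\<^sub>L 'h"
      by transfer simp
    have "Re (cinner (blinfun_apply k x) x) = \<epsilon>\<^sup>2 * (norm (blinfun_apply u x))\<^sup>2
      - (norm (blinfun_apply a x))\<^sup>2 - \<epsilon>\<^sup>2 * (norm (blinfun_apply d x))\<^sup>2"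
      unfolding k_def blinfun.diff_left sc blinfun_apply_blinfun_compose cinner.diff_left cinner_scaleC_left
        adj[OF a] adj[OF u(1)] adj[OF d(1)]
      by (simp flip: of_real_mult of_real_power)
    moreover have "0 \<le> \<epsilon>\<^sup>2 * (norm (blinfun_apply d x))\<^sup>2" by simp
    ultimately have "(norm (blinfun_apply a x))\<^sup>2 \<le> \<epsilon>\<^sup>2 * (norm (blinfun_apply u x))\<^sup>2 + \<epsilon>\<^sup>2"
      using k1 by linarith
    also have "\<dots> \<le> \<epsilon>\<^sup>2 * (norm u)\<^sup>2 + \<epsilon>\<^sup>2"
      using norm_blinfun[of u x] nx by (intro add_right_mono mult_left_mono power_mono) auto
    also have "\<dots> \<le> (\<epsilon> * (norm u + 1))\<^sup>2"
      using \<epsilon> by (simp add: power_mult_distrib power2_sum distrib_left)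
    finally show ?thesis
      using \<epsilon> by (intro power2_le_imp_le[of "norm (blinfun_apply a x)"]) auto
  qed
  show ?thesis
  proof (intro exI[of _ F] conjI F(1) allI impI)
    fix x assume x: "\<forall>f\<in>F. cinner x f = 0"
    show "norm (blinfun_apply a x) \<le> \<epsilon> * (norm u + 1) * norm x"
    proof (cases "x = 0")
      case False
      then have "norm (blinfun_apply a (inverse (norm x) *\<^sub>R x)) \<le> \<epsilon> * (norm u + 1)"
        by (intro unit) (simp_all add: bspec[OF x] cinner.scaleR_left)
      then show ?thesis using False by (simp add: blinfun.scaleR_right field_simps)
    qed simp
  qed
qed

section \<open>Finite rank approximation and approximate eigenvectors\<close>

lemma compose_rank1: "a o\<^sub>L rank1 x y = rank1 (blinfun_apply a x) y" if "a \<in> cbounded_ops"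
  by (rule blinfun_eqI) (simp add: cbounded_opsD[OF that])

text \<open>Take \<open>R = a P\<close> for the orthogonal projection \<open>P\<close> onto the span
  of \<open>F\<close>: the range of \<open>1 - P\<close> is orthogonal to \<open>F\<close>, where
  \<open>a\<close> is small. The element \<open>u\<close> stands in for the identity operator, which
  is not assumed to lie in \<open>A\<close>.\<close>

lemma near_finite_rank:
  assumes a: "a \<in> A" and \<epsilon>: "0 < \<epsilon>" and le: "\<And>z. z \<in> unit_circle \<Longrightarrow> cmod (\<phi> a z) \<le> \<epsilon>"
    and u: "u \<in> A" "\<And>z. z \<in> unit_circle \<Longrightarrow> \<phi> u z = 1"
  obtains R where "R \<in> cvec.span (range (case_prod rank1))" "norm (a - R) \<le> \<epsilon> * (norm u + 1)"
proof -
  obtain F where F: "finite F"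
    "\<And>x. (\<forall>f\<in>F. cinner x f = 0) \<Longrightarrow> norm (blinfun_apply a x) \<le> \<epsilon> * (norm u + 1) * norm x"
    using small_on_finite_codimension[OF a \<epsilon> le u] by auto
  obtain I where I: "finite I"
    "\<And>x f. f \<in> F \<Longrightarrow> cinner (x - blinfun_apply (\<Sum>u\<in>I. rank1 u u) x) f = 0"
    "\<And>x. norm (x - blinfun_apply (\<Sum>u\<in>I. rank1 u u) x) \<le> norm x"
    by (rule finite_rank_projection[OF F(1)]) blast
  define P where "P = (\<Sum>u\<in>I. rank1 u u)"
  have aP: "a o\<^sub>L P = (\<Sum>u\<in>I. rank1 (blinfun_apply a u) u)"
    unfolding P_def bounded_bilinear.sum_right[OF bounded_bilinear_blinfun_compose]
    by (intro sum.cong refl compose_rank1 A_cbounded a)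
  show thesis
  proof (rule that)
    show "a o\<^sub>L P \<in> cvec.span (range (case_prod rank1))"
      unfolding aP by (intro cvec.span_sum cvec.span_base) auto
    show "norm (a - (a o\<^sub>L P)) \<le> \<epsilon> * (norm u + 1)"
    proof (rule norm_blinfun_bound)
      fix x
      have "norm (blinfun_apply (a - (a o\<^sub>L P)) x) = norm (blinfun_apply a (x - blinfun_apply P x))"
        by (simp add: blinfun.bilinear_simps)
      also have "\<dots> \<le> \<epsilon> * (norm u + 1) * norm (x - blinfun_apply P x)"
        by (intro F(2)) (simp add: P_def I)
      also have "\<dots> \<le> \<epsilon> * (norm u + 1) * norm x"
        using \<epsilon> I(3)[of x] by (intro mult_left_mono) (auto simp: P_def)
      finally show "norm (blinfun_apply (a - (a o\<^sub>L P)) x) \<le> \<epsilon> * (norm u + 1) * norm x" .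
    qed (use \<epsilon> in simp)
  qed
qed

text \<open>Otherwise \<open>b - b P\<close>, with \<open>P\<close> the projection onto the span of
  \<open>F\<close>, would have norm at most 1/2, while its symbol at \<open>z\<close> is still 1
  because that of \<open>P\<close> is 0. This contradicts \<open>norm_\<phi>_le\<close>.\<close>

lemma not_small_on_finite_codimension:
  assumes b: "b \<in> A" and z: "z \<in> unit_circle" and bz: "\<phi> b z = 1" and F: "finite F"
  shows "\<exists>x. (\<forall>f\<in>F. cinner x f = 0) \<and> norm x < 2 * norm (blinfun_apply b x)"
proof -
  have "\<not> (\<forall>x. (\<forall>f\<in>F. cinner x f = 0) \<longrightarrow> 2 * norm (blinfun_apply b x) \<le> norm x)"
  proof
    assume small: "\<forall>x. (\<forall>f\<in>F. cinner x f = 0) \<longrightarrow> 2 * norm (blinfun_apply b x) \<le> norm x"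
    obtain I where I: "finite I"
      "\<And>x f. f \<in> F \<Longrightarrow> cinner (x - blinfun_apply (\<Sum>u\<in>I. rank1 u u) x) f = 0"
      "\<And>x. norm (x - blinfun_apply (\<Sum>u\<in>I. rank1 u u) x) \<le> norm x"
      by (rule finite_rank_projection[OF F]) blast
    define P where "P = (\<Sum>u\<in>I. rank1 u u)"
    have PA: "P \<in> A" unfolding P_def by (intro A_sum rank1_A)
    have "norm (b - (b o\<^sub>L P)) \<le> 1 / 2"
    proof (rule norm_blinfun_bound)
      fix x
      have "2 * norm (blinfun_apply (b - (b o\<^sub>L P)) x) = 2 * norm (blinfun_apply b (x - blinfun_apply P x))"
        by (simp add: blinfun.bilinear_simps)
      also have "\<dots> \<le> norm (x - blinfun_apply P x)"
        using small by (simp add: P_def I)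
      also have "\<dots> \<le> norm x" using I(3)[of x] by (simp add: P_def)
      finally show "norm (blinfun_apply (b - (b o\<^sub>L P)) x) \<le> 1 / 2 * norm x" by simp
    qed simp
    moreover have "\<phi> (b - (b o\<^sub>L P)) z = 1"
    proof -
      have "\<phi> P z = 0" using z by (simp add: P_def \<phi>_sum rank1_A \<phi>_rank1)
      then show ?thesis using b PA z bz by (simp add: \<phi>_diff \<phi>_comp A_comp)
    qed
    ultimately show False
      using norm_\<phi>_le[of "b - (b o\<^sub>L P)" z] b PA z by (simp add: A_diff A_comp)
  qed
  then show ?thesis by (auto simp: not_less[symmetric])
qed

text \<open>
  The approximate eigenvectors are \<open>b x / \<parallel>b x\<parallel>\<close>, where \<open>\<phi> b\<close> is a bump function concentrated
  at the point \<open>1\<close>.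
\<close>

lemma approximate_eigenvector:
  assumes T: "T \<in> A" "\<And>z. z \<in> unit_circle \<Longrightarrow> \<phi> T z = z" and F: "finite F" and \<delta>: "0 < \<delta>"
  obtains y where "norm y = 1" "\<And>f. f \<in> F \<Longrightarrow> cinner y f = 0"
    "norm (blinfun_apply T y - y) \<le> \<delta>" "norm (blinfun_apply (adj T) y - y) \<le> \<delta>"
proof -
  obtain u where u: "u \<in> A" "\<And>z. z \<in> unit_circle \<Longrightarrow> \<phi> u z = 1"
    using lift_exists[of "\<lambda>_. 1"] by auto
  \<comment> \<open>The factor \<open>norm u + 1\<close> cancels the constant of
    \<open>small_on_finite_codimension\<close>; the 2 absorbs the ratio of \<open>norm x\<close> to
    the norm of \<open>b x\<close>.\<close>
  define \<epsilon> where "\<epsilon> = \<delta> / (2 * (norm u + 1))"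
  have pos: "norm u + 1 > 0" by (simp add: add_nonneg_pos)
  have \<epsilon>: "0 < \<epsilon>" using \<delta> pos by (simp add: \<epsilon>_def)
  obtain b where b: "b \<in> A"
    "\<And>z. z \<in> unit_circle \<Longrightarrow> \<phi> b z = complex_of_real (max 0 (1 - cmod (z - 1) / \<epsilon>))"
  proof (rule lift_exists)
    fix a assume "a \<in> A"
      "\<And>z. z \<in> unit_circle \<Longrightarrow> \<phi> a z = complex_of_real (max 0 (1 - cmod (z - 1) / \<epsilon>))"
    then show thesis using that by blast
  next
    show "continuous_on unit_circle (\<lambda>z. complex_of_real (max 0 (1 - cmod (z - 1) / \<epsilon>)))"
      using \<epsilon> by (intro continuous_intros) auto
  qed
  have bump: "cmod (z - 1) * max 0 (1 - cmod (z - 1) / \<epsilon>) \<le> \<epsilon>" for z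
  proof (cases "cmod (z - 1) \<le> \<epsilon>")
    case True
    have "cmod (z - 1) * max 0 (1 - cmod (z - 1) / \<epsilon>) \<le> cmod (z - 1) * 1"
      using \<epsilon> by (intro mult_left_mono) auto
    then show ?thesis using True by simp
  next
    case False
    then have "1 - cmod (z - 1) / \<epsilon> \<le> 0" using \<epsilon> by simp
    then show ?thesis using \<epsilon> by (simp add: max_def)
  qed
  \<comment> \<open>Since \<open>cnj z - 1\<close> and \<open>z - 1\<close> have the same modulus,
    one bump function serves both \<open>T\<close> and its adjoint.\<close>
  have small: "cmod (\<phi> ((S o\<^sub>L b) - b) z) \<le> \<epsilon>" if "S \<in> {T, adj T}" "z \<in> unit_circle" for S z
  proof -
    have "\<phi> ((S o\<^sub>L b) - b) z = (\<phi> S z - 1) * \<phi> b z"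
      using that T b(1) by (auto simp: \<phi>_diff \<phi>_comp A_comp A_adj algebra_simps)
    moreover have "cmod (\<phi> S z - 1) = cmod (z - 1)"
      using that T complex_mod_cnj[of "z - 1"] by (auto simp: \<phi>_adj)
    ultimately show ?thesis
      using bump[of z] b(2)[OF that(2)] by (simp add: norm_mult del: complex_mod_cnj)
  qed
  have G: "\<exists>G. finite G \<and> (\<forall>x. (\<forall>f\<in>G. cinner x f = 0) \<longrightarrow>
      norm (blinfun_apply ((S o\<^sub>L b) - b) x) \<le> \<epsilon> * (norm u + 1) * norm x)" if "S \<in> {T, adj T}" for S
  proof -
    have "(S o\<^sub>L b) - b \<in> A" using that T(1) b(1) by (auto intro: A_adj A_comp A_diff)
    then show ?thesis
      using small[OF that] by (rule small_on_finite_codimension[OF _ \<epsilon> _ u])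
  qed
  obtain G1 where G1: "finite G1" "\<And>x. (\<forall>f\<in>G1. cinner x f = 0) \<Longrightarrow>
      norm (blinfun_apply ((T o\<^sub>L b) - b) x) \<le> \<epsilon> * (norm u + 1) * norm x"
    using G[of T] by blast
  obtain G2 where G2: "finite G2" "\<And>x. (\<forall>f\<in>G2. cinner x f = 0) \<Longrightarrow>
      norm (blinfun_apply ((adj T o\<^sub>L b) - b) x) \<le> \<epsilon> * (norm u + 1) * norm x"
    using G[of "adj T"] by blast
  \<comment> \<open>Orthogonality to \<open>G1\<close> and \<open>G2\<close> makes the two defects
    small; orthogonality to the image of \<open>F\<close> under \<open>adj b\<close> makes
    \<open>b x\<close> orthogonal to \<open>F\<close>.\<close>
  define H where "H = G1 \<union> G2 \<union> blinfun_apply (adj b) ` F"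
  have "finite H" using G1(1) G2(1) F by (simp add: H_def)
  moreover have "\<phi> b 1 = 1" using b(2)[of 1] by simp
  ultimately obtain x where x: "\<And>f. f \<in> H \<Longrightarrow> cinner x f = 0" "norm x < 2 * norm (blinfun_apply b x)"
    using not_small_on_finite_codimension[OF b(1), of 1 H] by (metis dist_0_norm mem_sphere norm_one)
  define t where "t = inverse (norm (blinfun_apply b x))"
  define y where "y = t *\<^sub>R blinfun_apply b x"
  have bx: "0 < norm (blinfun_apply b x)" using x(2) norm_ge_zero[of x] by linarith
  then have t: "0 < t" "t * norm x \<le> 2"
    using x(2) by (simp_all add: t_def field_simps)
  have "norm (blinfun_apply S y - y) \<le> \<delta>" if "S \<in> {T, adj T}" for S
  proof -
    have "blinfun_apply S y - y = t *\<^sub>R blinfun_apply ((S o\<^sub>L b) - b) x"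
      by (simp add: y_def blinfun.bilinear_simps scaleR_diff_right)
    then have "norm (blinfun_apply S y - y) = t * norm (blinfun_apply ((S o\<^sub>L b) - b) x)"
      using t(1) by simp
    also have "\<dots> \<le> t * (\<epsilon> * (norm u + 1) * norm x)"
      using G1(2)[of x] G2(2)[of x] x(1) that t(1) by (intro mult_left_mono) (auto simp: H_def)
    also have "\<dots> = (\<delta> / 2) * (t * norm x)" using pos by (simp add: \<epsilon>_def field_simps)
    also have "\<dots> \<le> (\<delta> / 2) * 2" using t(2) \<delta> by (intro mult_left_mono) auto
    finally show ?thesis by simp
  qed
  moreover have "norm y = 1"
    using bx by (simp add: y_def t_def)
  moreover have "cinner y f = 0" if "f \<in> F" for f
    using that x(1)[of "blinfun_apply (adj b) f"] cinner_adj[OF A_cbounded[OF b(1)], of x f]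
    by (simp add: y_def cinner.scaleR_left H_def)
  ultimately show thesis using that by blast
qed

text \<open>Symbols of elements of \<open>C\<close> include all real polynomials in the real and
  imaginary parts of \<open>z\<close>, so by Stone-Weierstrass they approximate every continuous
  symbol. The remainder has small symbol, hence is near the span of the rank one operators, which
  lies in \<open>C\<close>. So \<open>C\<close> is dense in \<open>A\<close>, and it is
  closed.\<close>

lemma subalgebra_eqI:
  assumes C: "cvec.subspace C" "\<And>a b. a \<in> C \<Longrightarrow> b \<in> C \<Longrightarrow> a o\<^sub>L b \<in> C" "\<And>a. a \<in> C \<Longrightarrow> adj a \<in> C"
      "closed C" "C \<subseteq> A"
    and T: "T \<in> C" "\<And>z. z \<in> unit_circle \<Longrightarrow> \<phi> T z = z"
    and R: "\<And>x y. rank1 x y \<in> C"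
  shows "C = A"
proof -
  note C_add = cvec.subspace_add[OF C(1)] and C_scale = cvec.subspace_scale[OF C(1)]
    and C_diff = cvec.subspace_diff[OF C(1)]
  have CA: "a \<in> C \<Longrightarrow> a \<in> A" for a using C(5) by blast
  \<comment> \<open>As \<open>z\<close> has modulus 1, the symbol of \<open>u\<close> is constantly
    1; this yields the constant polynomials inside \<open>C\<close>.\<close>
  define u where "u = adj T o\<^sub>L T"
  have uC: "u \<in> C" using C(2,3) T(1) by (simp add: u_def)
  have u1: "\<phi> u z = 1" if z: "z \<in> unit_circle" for z
  proof -
    have "cnj z * z = complex_of_real ((cmod z)\<^sup>2)"
      by (simp only: complex_norm_square mult.commute)
    then show ?thesis using z T CA[OF T(1)] by (simp add: u_def \<phi>_comp \<phi>_adj A_adj)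
  qed
  have poly: "\<exists>b\<in>C. \<forall>z\<in>unit_circle. \<phi> b z = complex_of_real (p z)"
    if "real_polynomial_function p" for p
    using that
  proof induction
    case (linear f)
    interpret f: bounded_linear f by fact
    \<comment> \<open>This realises \<open>f z = Re z * f 1 + Im z * f \<i>\<close> with
      \<open>Re z = (z + cnj z) / 2\<close> and
      \<open>Im z = - \<i> * (z - cnj z) / 2\<close>.\<close>
    let ?b = "(complex_of_real (f 1) / 2) *\<^sub>C (T + adj T) - (\<i> * complex_of_real (f \<i>) / 2) *\<^sub>C (T - adj T)"
    have "\<phi> ?b z = complex_of_real (f z)" if z: "z \<in> unit_circle" for z
    proof -
      have "\<phi> ?b z = complex_of_real (f 1) / 2 * (z + cnj z) - \<i> * complex_of_real (f \<i>) / 2 * (z - cnj z)"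
        using z CA[OF T(1)] T(2)
        by (simp add: \<phi>_add \<phi>_diff \<phi>_scale \<phi>_adj A_add A_diff A_scale A_adj)
      also have "\<dots> = complex_of_real (Re z * f 1 + Im z * f \<i>)"
        by (simp add: complex_eq_iff)
      also have "Re z * f 1 + Im z * f \<i> = f (Re z *\<^sub>R 1 + Im z *\<^sub>R \<i>)"
        by (simp only: f.add f.scaleR real_scaleR_def)
      also have "Re z *\<^sub>R 1 + Im z *\<^sub>R \<i> = z" by (simp add: complex_eq_iff)
      finally show ?thesis .
    qed
    moreover have "?b \<in> C" by (intro C_add C_diff C_scale C(3) T(1))
    ultimately show ?case by blast
  next
    case (const c)
    have "\<phi> (complex_of_real c *\<^sub>C u) z = complex_of_real c" if "z \<in> unit_circle" for z
      using \<phi>_scale[OF CA[OF uC] that] u1[OF that] by simp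
    then show ?case using C_scale[OF uC] by blast
  next
    case (add p q)
    then obtain b c where bc: "b \<in> C" "\<forall>z\<in>unit_circle. \<phi> b z = complex_of_real (p z)"
      "c \<in> C" "\<forall>z\<in>unit_circle. \<phi> c z = complex_of_real (q z)" by blast
    have "\<phi> (b + c) z = complex_of_real (p z + q z)" if "z \<in> unit_circle" for z
      using \<phi>_add[OF CA[OF bc(1)] CA[OF bc(3)] that] bc(2,4) that by simp
    then show ?case using C_add[OF bc(1,3)] by blast
  next
    case (mult p q)
    then obtain b c where bc: "b \<in> C" "\<forall>z\<in>unit_circle. \<phi> b z = complex_of_real (p z)"
      "c \<in> C" "\<forall>z\<in>unit_circle. \<phi> c z = complex_of_real (q z)" by blast
    have "\<phi> (b o\<^sub>L c) z = complex_of_real (p z * q z)" if "z \<in> unit_circle" for z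
      using \<phi>_comp[OF CA[OF bc(1)] CA[OF bc(3)] that] bc(2,4) that by simp
    then show ?case using C(2)[OF bc(1,3)] by blast
  qed
  have "a \<in> C" if a: "a \<in> A" for a
  proof -
    have "\<exists>b\<in>C. dist b a < e" if e: "0 < e" for e
    proof -
      have up: "0 < norm u + 1" by (simp add: add_nonneg_pos)
      \<comment> \<open>Chosen so that the bound \<open>\<delta> * (norm u + 1)\<close> of
        \<open>near_finite_rank\<close> is \<open>e / 2\<close>; the real and imaginary parts get
        \<open>\<delta> / 2\<close> each.\<close>
      define \<delta> where "\<delta> = e / (2 * (norm u + 1))"
      have \<delta>: "0 < \<delta>" using e up by (simp add: \<delta>_def)
      have cont: "continuous_on unit_circle (\<lambda>z. Re (\<phi> a z))" "continuous_on unit_circle (\<lambda>z. Im (\<phi> a z))"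
        by (intro continuous_intros \<phi>_continuous[OF a])+
      have "0 < \<delta> / 2" using \<delta> by simp
      note SW = Stone_Weierstrass_real_polynomial_function[OF compact_sphere _ this]
      obtain p where p: "real_polynomial_function p"
        "\<And>z. z \<in> unit_circle \<Longrightarrow> \<bar>Re (\<phi> a z) - p z\<bar> < \<delta> / 2"
        using SW[OF cont(1)] by blast
      obtain q where q: "real_polynomial_function q"
        "\<And>z. z \<in> unit_circle \<Longrightarrow> \<bar>Im (\<phi> a z) - q z\<bar> < \<delta> / 2"
        using SW[OF cont(2)] by blast
      obtain b where b: "b \<in> C" "\<And>z. z \<in> unit_circle \<Longrightarrow> \<phi> b z = complex_of_real (p z)"
        using poly[OF p(1)] by blast
      obtain c where c: "c \<in> C" "\<And>z. z \<in> unit_circle \<Longrightarrow> \<phi> c z = complex_of_real (q z)"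
        using poly[OF q(1)] by blast
      define d where "d = b + \<i> *\<^sub>C c"
      have dC: "d \<in> C" unfolding d_def by (intro C_add C_scale b c)
      have "cmod (\<phi> (a - d) z) \<le> \<delta>" if z: "z \<in> unit_circle" for z
      proof -
        have "\<phi> (a - d) z = \<phi> a z - (complex_of_real (p z) + \<i> * complex_of_real (q z))"
          unfolding d_def using z a CA[OF b(1)] CA[OF c(1)] b(2)[OF z] c(2)[OF z]
          by (simp add: \<phi>_diff \<phi>_add \<phi>_scale A_add A_scale)
        then have "cmod (\<phi> (a - d) z) \<le> \<bar>Re (\<phi> a z) - p z\<bar> + \<bar>Im (\<phi> a z) - q z\<bar>"
          using cmod_le[of "\<phi> (a - d) z"] by simp
        then show ?thesis using p(2)[OF z] q(2)[OF z] by simp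
      qed
      then obtain r where r: "r \<in> cvec.span (range (case_prod rank1))"
        "norm ((a - d) - r) \<le> \<delta> * (norm u + 1)"
        using near_finite_rank[OF A_diff[OF a CA[OF dC]] \<delta> _ CA[OF uC] u1] by blast
      have "cvec.span (range (case_prod rank1)) \<subseteq> C"
        using R C(1) by (intro cvec.span_minimal) auto
      then have "d + r \<in> C" using C_add[OF dC] r(1) by blast
      moreover have "dist (d + r) a < e"
      proof -
        have "dist (d + r) a = norm ((a - d) - r)" by (simp add: dist_norm norm_minus_commute diff_diff_eq)
        also have "\<dots> \<le> e / 2"
        proof -
          have "e / (2 * k) * k = e / 2" if "0 < k" for k :: real using that by simp
          then have "\<delta> * (norm u + 1) = e / 2" unfolding \<delta>_def using up by blast
          then show ?thesis using r(2) by simp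
        qed
        finally show ?thesis using e by simp
      qed
      ultimately show ?thesis by blast
    qed
    then show ?thesis using closed_approachable[OF C(4)] by blast
  qed
  then show ?thesis using C(5) by blast
qed

text \<open>Dependent choice: at stage \<open>n\<close> only the finitely many vectors
  \<open>e i\<close> and \<open>y i\<close> with \<open>i < n\<close> have to be avoided. The
  sequence \<open>y\<close> will be taken dense, to control operators of rank one.\<close>

lemma asymptotic_eigenbasis:
  fixes y :: "nat \<Rightarrow> 'h"
  assumes T: "T \<in> A" "\<And>z. z \<in> unit_circle \<Longrightarrow> \<phi> T z = z"
  obtains e where "\<And>n. norm (e n) = 1" "\<And>i n. i < n \<Longrightarrow> cinner (e n) (e i) = 0"
    "\<And>i n. i < n \<Longrightarrow> cinner (e n) (y i) = 0"
    "\<And>n. norm (blinfun_apply T (e n) - e n) \<le> (1/2) ^ n"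
    "\<And>n. norm (blinfun_apply (adj T) (e n) - e n) \<le> (1/2) ^ n"
proof -
  define P where "P e n v \<longleftrightarrow> norm v = 1 \<and> (\<forall>i<n. cinner v (e i) = 0 \<and> cinner v (y i) = 0) \<and>
    norm (blinfun_apply T v - v) \<le> (1/2) ^ n \<and> norm (blinfun_apply (adj T) v - v) \<le> (1/2) ^ n"
    for e :: "nat \<Rightarrow> 'h" and n v
  have "\<exists>e. \<forall>n. P e n (e n)"
  proof (rule dependent_wellorder_choice)
    show "P f x r = P g x r" if "\<And>y. y < x \<Longrightarrow> f y = g y" for r f g x
      using that by (simp add: P_def)
    show "\<exists>r. P f n r" for n f
    proof -
      obtain v where "norm v = 1" "\<And>w. w \<in> f ` {..<n} \<union> y ` {..<n} \<Longrightarrow> cinner v w = 0"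
        "norm (blinfun_apply T v - v) \<le> (1/2) ^ n" "norm (blinfun_apply (adj T) v - v) \<le> (1/2) ^ n"
        using approximate_eigenvector[OF T, of "f ` {..<n} \<union> y ` {..<n}" "(1/2) ^ n"] by auto
      then show ?thesis unfolding P_def by blast
    qed
  qed
  then show thesis using that unfolding P_def by blast
qed

end

section \<open>Products of inner automorphisms\<close>

text \<open>The norm condition holds for conjugation by a unitary and passes to products.
  Convergence estimates uniform in \<open>n\<close> and membership in the isometry group both draw
  on it.\<close>

definition isometric_star_automorphisms ::
  "('h::complex_hilbert_space \<Rightarrow>\<^sub>L 'h) set \<Rightarrow> (('h \<Rightarrow>\<^sub>L 'h) \<Rightarrow> ('h \<Rightarrow>\<^sub>L 'h)) set" where
  "isometric_star_automorphisms A = {\<Phi> \<in> star_automorphisms A. \<forall>a\<in>A. norm (\<Phi> a) = norm a}"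

lemma isometric_star_automorphismsD:
  assumes "\<Phi> \<in> isometric_star_automorphisms A"
  shows "\<And>a. a \<in> A \<Longrightarrow> \<Phi> a \<in> A" "\<And>a b. a \<in> A \<Longrightarrow> b \<in> A \<Longrightarrow> \<Phi> (a + b) = \<Phi> a + \<Phi> b"
    "\<And>a c. a \<in> A \<Longrightarrow> \<Phi> (c *\<^sub>C a) = c *\<^sub>C \<Phi> a"
    "\<And>a b. a \<in> A \<Longrightarrow> b \<in> A \<Longrightarrow> \<Phi> (a o\<^sub>L b) = \<Phi> a o\<^sub>L \<Phi> b"
    "\<And>a. a \<in> A \<Longrightarrow> \<Phi> (adj a) = adj (\<Phi> a)" "\<And>a. a \<in> A \<Longrightarrow> norm (\<Phi> a) = norm a"
    "bij_betw \<Phi> A A" "\<Phi> \<in> extensional A"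
  using assms
  by (auto simp: isometric_star_automorphisms_def star_automorphisms_def automorphism_group_def
      clinear_on_def PiE_def)

lemma isometric_star_automorphismsI:
  assumes "\<And>a. a \<in> A \<Longrightarrow> \<Phi> a \<in> A" "\<And>a b. a \<in> A \<Longrightarrow> b \<in> A \<Longrightarrow> \<Phi> (a + b) = \<Phi> a + \<Phi> b"
    "\<And>a c. a \<in> A \<Longrightarrow> \<Phi> (c *\<^sub>C a) = c *\<^sub>C \<Phi> a"
    "\<And>a b. a \<in> A \<Longrightarrow> b \<in> A \<Longrightarrow> \<Phi> (a o\<^sub>L b) = \<Phi> a o\<^sub>L \<Phi> b"
    "\<And>a. a \<in> A \<Longrightarrow> \<Phi> (adj a) = adj (\<Phi> a)" "\<And>a. a \<in> A \<Longrightarrow> norm (\<Phi> a) = norm a"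
    "bij_betw \<Phi> A A" "\<Phi> \<in> extensional A"
  shows "\<Phi> \<in> isometric_star_automorphisms A"
  using assms
  by (auto simp: isometric_star_automorphisms_def star_automorphisms_def automorphism_group_def
      clinear_on_def PiE_def)

lemma isometric_star_automorphisms_isometry_group:
  "\<Phi> \<in> isometric_star_automorphisms A \<Longrightarrow> \<Phi> \<in> isometry_group A"
  by (auto simp: isometric_star_automorphisms_def star_automorphisms_def automorphism_group_def
      isometry_group_def bij_betw_def)

lemma isometric_star_automorphisms_automorphism_group:
  "\<Phi> \<in> isometric_star_automorphisms A \<Longrightarrow> \<Phi> \<in> automorphism_group A"
  by (simp add: isometric_star_automorphisms_def star_automorphisms_def)

text \<open>Each new factor acts first, inside the earlier ones. For isometric linear factors,
  adding \<open>\<alpha> n\<close> therefore moves the value at \<open>a\<close> by exactly the norm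
  of \<open>\<alpha> n a - a\<close>, whatever the earlier factors are.\<close>

primrec compose_seq :: "'x set \<Rightarrow> (nat \<Rightarrow> 'x \<Rightarrow> 'x) \<Rightarrow> nat \<Rightarrow> 'x \<Rightarrow> 'x" where
  "compose_seq X \<alpha> 0 = (\<lambda>x\<in>X. x)"
| "compose_seq X \<alpha> (Suc n) = compose X (compose_seq X \<alpha> n) (\<alpha> n)"

text \<open>If \<open>f\<close> is the difference of two orthonormal vectors, this operator
  exchanges them and fixes every vector orthogonal to both.\<close>

definition reflection :: "'h::complex_hilbert_space \<Rightarrow> ('h \<Rightarrow>\<^sub>L 'h)" where
  "reflection f = id_blinfun - rank1 f f"

definition conj_reflection :: "'h::complex_hilbert_space \<Rightarrow> ('h \<Rightarrow>\<^sub>L 'h) \<Rightarrow> ('h \<Rightarrow>\<^sub>L 'h)" where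
  "conj_reflection f a = reflection f o\<^sub>L a o\<^sub>L reflection f"

lemma reflection_apply: "blinfun_apply (reflection f) x = x - cinner x f *\<^sub>C f"
  by (simp add: reflection_def blinfun.diff_left)

lemma reflection_cbounded: "reflection f \<in> cbounded_ops"
  by (simp add: cbounded_ops_def reflection_apply cinner_scaleC_left cvec.scale_right_diff_distrib scaleC_scaleC)

lemma cinner_reflection:
  "cinner (blinfun_apply (reflection f) x) y = cinner x (blinfun_apply (reflection f) y)"
  by (simp add: reflection_apply cinner.diff_left cinner.diff_right cinner_scaleC_left
      cinner_scaleC_right cinner_commute[of f y])

text \<open>The vector is normalised so that \<open>f f\<^sup>*\<close> is twice a projection, which makes the reflection unitary.\<close>

lemma reflection_involution:
  assumes "(norm f)\<^sup>2 = 2"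
  shows "blinfun_apply (reflection f) (blinfun_apply (reflection f) x) = x"
proof -
  have "cinner f f = 2" by (simp add: cinner_self assms)
  then show ?thesis
    by (simp add: reflection_apply cinner.diff_left cinner_scaleC_left)
qed

lemma norm_reflection_le:
  assumes "(norm f)\<^sup>2 = 2"
  shows "norm (reflection f) \<le> 1"
proof (rule norm_blinfun_bound)
  fix x
  have "cinner (blinfun_apply (reflection f) x) (blinfun_apply (reflection f) x) = cinner x x"
    by (simp add: cinner_reflection reflection_involution[OF assms])
  then have "(norm (blinfun_apply (reflection f) x))\<^sup>2 = (norm x)\<^sup>2"
    by (metis cinner_self_Re)
  then show "norm (blinfun_apply (reflection f) x) \<le> 1 * norm x" by simp
qed simp

lemma conj_reflection_involution:
  assumes "(norm f)\<^sup>2 = 2"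
  shows "conj_reflection f (conj_reflection f a) = a"
  by (rule blinfun_eqI) (simp add: conj_reflection_def reflection_involution[OF assms])

text \<open>Conjugation does not increase norms, and it is its own inverse.\<close>

lemma norm_conj_reflection:
  assumes "(norm f)\<^sup>2 = 2"
  shows "norm (conj_reflection f a) = norm a"
proof -
  have le: "norm (conj_reflection f b) \<le> norm b" for b
  proof -
    have "norm (conj_reflection f b) \<le> norm (reflection f o\<^sub>L b) * norm (reflection f)"
      unfolding conj_reflection_def by (rule norm_blinfun_compose)
    also have "\<dots> \<le> (norm (reflection f) * norm b) * norm (reflection f)"
      by (intro mult_right_mono norm_blinfun_compose) simp
    also have "\<dots> \<le> (1 * norm b) * 1"
      using norm_reflection_le[OF assms] by (intro mult_mono) auto
    finally show ?thesis by simp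
  qed
  show ?thesis
    using le[of a] le[of "conj_reflection f a"] by (simp add: conj_reflection_involution[OF assms])
qed

lemma conj_reflection_rank1:
  "conj_reflection f (rank1 x y) = rank1 (blinfun_apply (reflection f) x) (blinfun_apply (reflection f) y)"
  by (rule blinfun_eqI)
    (simp add: conj_reflection_def cbounded_opsD[OF reflection_cbounded] cinner_reflection)

lemma adj_conj_reflection:
  assumes "a \<in> cbounded_ops"
  shows "adj (conj_reflection f a) = conj_reflection f (adj a)"
  by (rule adj_unique) (simp add: conj_reflection_def cinner_reflection cinner_adj[OF assms])

text \<open>\<open>W a W - a = (W a - a W) W\<close> for \<open>W = 1 - f f\<^sup>*\<close>.\<close>

lemma norm_conj_reflection_diff_le:
  assumes a: "a \<in> cbounded_ops" and f: "(norm f)\<^sup>2 = 2"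
  shows "norm (conj_reflection f a - a)
    \<le> 2 * (norm (blinfun_apply a f - f) + norm (blinfun_apply (adj a) f - f))"
proof -
  define g h where "g = blinfun_apply a f - f" and "h = blinfun_apply (adj a) f - f"
  have "conj_reflection f a - a = (rank1 g f - rank1 f h) o\<^sub>L reflection f"
  proof (rule blinfun_eqI)
    fix x
    define w where "w = blinfun_apply (reflection f) x"
    have x: "x = blinfun_apply (reflection f) w" by (simp add: w_def reflection_involution[OF f])
    have "blinfun_apply (conj_reflection f a - a) x
        = blinfun_apply (reflection f) (blinfun_apply a w) - blinfun_apply a (blinfun_apply (reflection f) w)"
      by (simp add: conj_reflection_def blinfun.diff_left flip: w_def x)
    also have "\<dots> = cinner w f *\<^sub>C blinfun_apply a f - cinner (blinfun_apply a w) f *\<^sub>C f"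
      by (simp add: reflection_apply blinfun.diff_right cbounded_opsD[OF a])
    \<comment> \<open>The vector \<open>cinner w f *\<^sub>C f\<close> is subtracted from both
      summands, after the second coefficient has been rewritten through the adjoint.\<close>
    also have "\<dots> = cinner w f *\<^sub>C g - cinner w h *\<^sub>C f"
      by (simp add: cinner_adj[OF a] g_def h_def cinner.diff_right cvec.scale_right_diff_distrib
          cvec.scale_left_diff_distrib)
    finally show "blinfun_apply (conj_reflection f a - a) x
        = blinfun_apply ((rank1 g f - rank1 f h) o\<^sub>L reflection f) x"
      by (simp add: blinfun.diff_left w_def)
  qed
  then have "norm (conj_reflection f a - a) \<le> norm (rank1 g f - rank1 f h) * norm (reflection f)"
    by (simp add: norm_blinfun_compose)
  also have "\<dots> \<le> norm (rank1 g f - rank1 f h) * 1"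
    by (intro mult_left_mono norm_reflection_le f) simp
  also have "\<dots> \<le> norm g * norm f + norm f * norm h"
    using norm_triangle_ineq4[of "rank1 g f" "rank1 f h"] norm_rank1_le[of g f] norm_rank1_le[of f h]
    by simp
  also have "\<dots> = norm f * (norm g + norm h)" by (simp add: algebra_simps)
  also have "\<dots> \<le> 2 * (norm g + norm h)"
  proof (rule mult_right_mono)
    have "(norm f)\<^sup>2 \<le> 2\<^sup>2" using f by simp
    then show "norm f \<le> 2" by (rule power2_le_imp_le) simp
  qed simp
  finally show ?thesis by (simp add: g_def h_def)
qed

section \<open>Automorphisms of \<open>A\<close> obtained from reflections\<close>

context circle_extension
begin

text \<open>Expanding both factors leaves \<open>a\<close> and products of \<open>a\<close> with
  \<open>?q\<close>, so the conjugate lies in \<open>A\<close> even if the reflection does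
  not.\<close>

lemma conj_reflection_A:
  assumes a: "a \<in> A" shows "conj_reflection f a \<in> A"
proof -
  let ?q = "rank1 f f"
  have "conj_reflection f a = a - (?q o\<^sub>L a) - (a o\<^sub>L ?q) + (?q o\<^sub>L a o\<^sub>L ?q)"
    by (rule blinfun_eqI)
      (simp add: conj_reflection_def reflection_def blinfun.bilinear_simps)
  then show ?thesis using a by (simp add: A_add A_diff A_comp rank1_A)
qed

lemma conj_reflection_automorphism:
  assumes f: "(norm f)\<^sup>2 = 2"
  shows "(\<lambda>a\<in>A. conj_reflection f a) \<in> isometric_star_automorphisms A"
proof (rule isometric_star_automorphismsI)
  note [simp] = A_add A_scale A_comp A_adj conj_reflection_A
  show "bij_betw (\<lambda>a\<in>A. conj_reflection f a) A A"
    by (rule bij_betw_byWitness[where f' = "conj_reflection f"])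
      (auto simp: conj_reflection_involution[OF f])
  show "(\<lambda>a\<in>A. conj_reflection f a) (a + b) = (\<lambda>a\<in>A. conj_reflection f a) a + (\<lambda>a\<in>A. conj_reflection f a) b"
    if "a \<in> A" "b \<in> A" for a b
    using that by (simp, intro blinfun_eqI) (simp add: conj_reflection_def blinfun.bilinear_simps)
  show "(\<lambda>a\<in>A. conj_reflection f a) (c *\<^sub>C a) = c *\<^sub>C (\<lambda>a\<in>A. conj_reflection f a) a"
    if "a \<in> A" for a c
  proof -
    have "blinfun_apply (c *\<^sub>C S) y = c *\<^sub>C blinfun_apply S y" for c y and S :: "'h \<Rightarrow>\<^sub>L 'h"
      by transfer simp
    then show ?thesis using that
      by (simp, intro blinfun_eqI) (simp add: conj_reflection_def cbounded_opsD[OF reflection_cbounded])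
  qed
  show "(\<lambda>a\<in>A. conj_reflection f a) (a o\<^sub>L b) = (\<lambda>a\<in>A. conj_reflection f a) a o\<^sub>L (\<lambda>a\<in>A. conj_reflection f a) b"
    if "a \<in> A" "b \<in> A" for a b
    using that by (simp, intro blinfun_eqI) (simp add: conj_reflection_def reflection_involution[OF f])
qed (auto simp: norm_conj_reflection[OF f] adj_conj_reflection A_cbounded A_adj conj_reflection_A)

lemma compose_seq_automorphism:
  assumes \<alpha>: "\<And>n. \<alpha> n \<in> isometric_star_automorphisms A"
  shows "compose_seq A \<alpha> n \<in> isometric_star_automorphisms A"
proof (induction n)
  case 0
  show ?case
    by (rule isometric_star_automorphismsI)
      (auto simp: A_add A_scale A_comp A_adj bij_betw_def inj_on_def extensional_def)
next
  case (Suc n)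
  note a = isometric_star_automorphismsD[OF \<alpha>[of n]] and S = isometric_star_automorphismsD[OF Suc]
  show ?case
    by (rule isometric_star_automorphismsI)
      (auto simp: compose_def extensional_def A_add A_scale A_comp A_adj a(1-6) S(1-6)
        intro: bij_betw_trans[OF a(7) S(7), unfolded comp_def, THEN bij_betw_cong[THEN iffD1, rotated]])
qed

end

section \<open>The limit endomorphism\<close>

lemma tendsto_scaleC:
  fixes l :: "'a::complex_normed_vector"
  assumes "(x \<longlongrightarrow> l) F"
  shows "((\<lambda>n. c *\<^sub>C x n) \<longlongrightarrow> c *\<^sub>C l) F"
proof -
  have "bounded_linear (\<lambda>y::'a. c *\<^sub>C y)"
    by (rule bounded_linear_intro[where K = "cmod c"])
      (simp_all add: scaleC_add_right scaleR_eq_scaleC scaleC_scaleC norm_scaleC mult.commute)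
  then show ?thesis by (rule bounded_linear.tendsto) fact
qed

locale automorphism_sequence = circle_extension A \<phi>
  for A :: "('h::complex_hilbert_space \<Rightarrow>\<^sub>L 'h) set" and \<phi> +
  fixes \<Phi> :: "nat \<Rightarrow> ('h \<Rightarrow>\<^sub>L 'h) \<Rightarrow> ('h \<Rightarrow>\<^sub>L 'h)"
  assumes automorphisms: "\<And>n. \<Phi> n \<in> isometric_star_automorphisms A"
begin

lemmas \<Phi>_mem = isometric_star_automorphismsD(1)[OF automorphisms]
  and \<Phi>_add = isometric_star_automorphismsD(2)[OF automorphisms]
  and \<Phi>_scale = isometric_star_automorphismsD(3)[OF automorphisms]
  and \<Phi>_comp = isometric_star_automorphismsD(4)[OF automorphisms]
  and \<Phi>_adj = isometric_star_automorphismsD(5)[OF automorphisms]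
  and norm_\<Phi> = isometric_star_automorphismsD(6)[OF automorphisms]

lemma \<Phi>_diff: "a \<in> A \<Longrightarrow> b \<in> A \<Longrightarrow> \<Phi> n (a - b) = \<Phi> n a - \<Phi> n b"
  using \<Phi>_add[of "a - b" b n] by (simp add: A_diff)

text \<open>Taking adjoints respects differences and does not increase norms. The limit is
  complex-linear because the closed set \<open>A\<close> contains it.\<close>

lemma tendsto_adj:
  assumes "\<And>n. x n \<in> A" "x \<longlonglongrightarrow> a"
  shows "(\<lambda>n. adj (x n)) \<longlonglongrightarrow> adj a"
proof -
  have a: "a \<in> A" using A_closed assms closed_sequentially by blast
  have "(\<lambda>n. norm (x n - a)) \<longlonglongrightarrow> 0"
    using assms(2) by (simp add: LIM_zero tendsto_norm_zero)
  moreover have "norm (adj (x n) - adj a) \<le> norm (x n - a)" for n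
    using norm_adj_le[OF A_cbounded[OF A_diff[OF assms(1) a]]]
    by (simp add: adj_diff A_cbounded assms(1) a)
  ultimately have "(\<lambda>n. adj (x n) - adj a) \<longlonglongrightarrow> 0"
    by (rule Lim_null_comparison[OF always_eventually[OF allI], rotated])
  then show ?thesis by (rule LIM_zero_cancel)
qed

text \<open>This turns out to be a closed star-subalgebra, so \<open>subalgebra_eqI\<close> reduces
  convergence on \<open>A\<close> to one lift of the identity function and the operators of rank
  one.\<close>

definition convergence_set :: "('h \<Rightarrow>\<^sub>L 'h) set" where
  "convergence_set = {a \<in> A. convergent (\<lambda>n. \<Phi> n a)}"

lemma convergence_set_subspace: "cvec.subspace convergence_set"
proof (rule cvec.subspaceI)
  have "\<Phi> n 0 = 0" for n using norm_\<Phi>[OF A_zero] by simp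
  then show "0 \<in> convergence_set" by (simp add: convergence_set_def A_zero convergent_const)
  show "a + b \<in> convergence_set" if "a \<in> convergence_set" "b \<in> convergence_set" for a b
    using that by (auto simp: convergence_set_def A_add \<Phi>_add intro: convergent_add)
  show "c *\<^sub>C a \<in> convergence_set" if ac: "a \<in> convergence_set" for c a
  proof -
    have a: "a \<in> A" using ac by (simp add: convergence_set_def)
    obtain l where "(\<lambda>n. \<Phi> n a) \<longlonglongrightarrow> l"
      using ac by (auto simp: convergence_set_def convergent_def)
    then have "(\<lambda>n. c *\<^sub>C \<Phi> n a) \<longlonglongrightarrow> c *\<^sub>C l"
      by (rule tendsto_scaleC)
    then show ?thesis
      by (simp add: convergence_set_def A_scale a \<Phi>_scale convergentI)
  qed
qed

lemma convergence_set_comp: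
  assumes "a \<in> convergence_set" "b \<in> convergence_set"
  shows "a o\<^sub>L b \<in> convergence_set"
proof -
  have ab: "a \<in> A" "b \<in> A" using assms by (auto simp: convergence_set_def)
  obtain l m where "(\<lambda>n. \<Phi> n a) \<longlonglongrightarrow> l" "(\<lambda>n. \<Phi> n b) \<longlonglongrightarrow> m"
    using assms by (auto simp: convergence_set_def convergent_def)
  then have "(\<lambda>n. \<Phi> n a o\<^sub>L \<Phi> n b) \<longlonglongrightarrow> (l o\<^sub>L m)"
    by (rule bounded_bilinear.tendsto[OF bounded_bilinear_blinfun_compose])
  then show ?thesis
    by (simp add: convergence_set_def A_comp ab \<Phi>_comp convergentI)
qed

lemma convergence_set_adj:
  assumes "a \<in> convergence_set"
  shows "adj a \<in> convergence_set"
proof -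
  have a: "a \<in> A" using assms by (simp add: convergence_set_def)
  obtain l where "(\<lambda>n. \<Phi> n a) \<longlonglongrightarrow> l"
    using assms by (auto simp: convergence_set_def convergent_def)
  then have "(\<lambda>n. adj (\<Phi> n a)) \<longlonglongrightarrow> adj l"
    by (rule tendsto_adj[OF \<Phi>_mem[OF a]])
  then show ?thesis
    by (simp add: convergence_set_def A_adj a \<Phi>_adj convergentI)
qed

text \<open>As every \<open>\<Phi> n\<close> is isometric, \<open>\<Phi> n b\<close> approximates
  \<open>\<Phi> n a\<close> uniformly in \<open>n\<close>; splitting \<open>e\<close> into thirds
  then gives a Cauchy sequence.\<close>

lemma convergence_set_closed: "closed convergence_set"
proof -
  have "a \<in> convergence_set" if close: "\<And>e. 0 < e \<Longrightarrow> \<exists>b\<in>convergence_set. dist b a < e" for a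
  proof -
    have "convergence_set \<subseteq> A" by (auto simp: convergence_set_def)
    then have a: "a \<in> A"
      using A_closed close by (meson closed_approachable subsetD)
    have "Cauchy (\<lambda>n. \<Phi> n a)"
    proof (rule metric_CauchyI)
      fix e :: real assume e: "0 < e"
      then obtain b where b: "b \<in> A" "convergent (\<lambda>n. \<Phi> n b)" "dist b a < e / 3"
        using close[of "e / 3"] by (auto simp: convergence_set_def)
      have near: "dist (\<Phi> n b) (\<Phi> n a) < e / 3" for n
        using b a norm_\<Phi>[of "b - a" n] by (simp add: dist_norm \<Phi>_diff A_diff)
      obtain M where M: "\<And>m n. m \<ge> M \<Longrightarrow> n \<ge> M \<Longrightarrow> dist (\<Phi> m b) (\<Phi> n b) < e / 3"
        using metric_CauchyD[OF convergent_Cauchy[OF b(2)], of "e / 3"] e by auto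
      have "dist (\<Phi> m a) (\<Phi> n a) < e" if "m \<ge> M" "n \<ge> M" for m n
        using M[OF that] near[of m] near[of n]
          dist_triangle[of "\<Phi> m a" "\<Phi> n a" "\<Phi> m b"] dist_triangle[of "\<Phi> m b" "\<Phi> n a" "\<Phi> n b"]
          dist_commute[of "\<Phi> m a" "\<Phi> m b"]
        by linarith
      then show "\<exists>M. \<forall>m\<ge>M. \<forall>n\<ge>M. dist (\<Phi> m a) (\<Phi> n a) < e" by blast
    qed
    then show ?thesis using a by (simp add: convergence_set_def Cauchy_convergent)
  qed
  then show ?thesis by (meson closed_limpt islimpt_approachable)
qed

lemma limit_star_endomorphism:
  assumes "convergence_set = A"
  shows "\<exists>\<Psi>\<in>star_endomorphisms A. \<forall>a\<in>A. (\<lambda>n. \<Phi> n a) \<longlonglongrightarrow> \<Psi> a"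
proof -
  define \<Psi> where "\<Psi> = (\<lambda>a\<in>A. lim (\<lambda>n. \<Phi> n a))"
  have lim: "(\<lambda>n. \<Phi> n a) \<longlonglongrightarrow> \<Psi> a" if "a \<in> A" for a
    using that assms by (auto simp: \<Psi>_def convergence_set_def convergent_LIMSEQ_iff)
  have lim': "\<Psi> a = L" if "(\<lambda>n. \<Phi> n a) \<longlonglongrightarrow> L" "a \<in> A" for a L
    using LIMSEQ_unique[OF lim[OF that(2)] that(1)] .
  have "\<Psi> a \<in> A" if "a \<in> A" for a
    using closed_sequentially[OF A_closed _ lim[OF that]] \<Phi>_mem[OF that] by blast
  moreover have "\<Psi> (a + b) = \<Psi> a + \<Psi> b" if "a \<in> A" "b \<in> A" for a b
    by (rule lim') (use that in \<open>auto simp: \<Phi>_add A_add intro: tendsto_add lim\<close>)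
  moreover have "\<Psi> (c *\<^sub>C a) = c *\<^sub>C \<Psi> a" if "a \<in> A" for a c
  proof (rule lim')
    show "(\<lambda>n. \<Phi> n (c *\<^sub>C a)) \<longlonglongrightarrow> c *\<^sub>C \<Psi> a"
      using tendsto_scaleC[OF lim[OF that]] by (simp add: \<Phi>_scale that)
  qed (use that in \<open>rule A_scale\<close>)
  moreover have "\<Psi> (a o\<^sub>L b) = \<Psi> a o\<^sub>L \<Psi> b" if "a \<in> A" "b \<in> A" for a b
    by (rule lim') (use that in \<open>auto simp: \<Phi>_comp A_comp
        intro: bounded_bilinear.tendsto[OF bounded_bilinear_blinfun_compose] lim\<close>)
  moreover have "\<Psi> (adj a) = adj (\<Psi> a)" if "a \<in> A" for a
    by (rule lim') (use that in \<open>auto simp: \<Phi>_adj A_adj \<Phi>_mem intro: tendsto_adj lim\<close>)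
  ultimately have "\<Psi> \<in> star_endomorphisms A"
    by (auto simp: star_endomorphisms_def clinear_on_def \<Psi>_def)
  then show ?thesis using lim by blast
qed

text \<open>
  If \<open>\<Psi> a = p\<close>, then \<open>\<Phi> n (a - r n) \<longlonglongrightarrow> 0\<close>, so that \<open>r\<close> would converge to \<open>a\<close>.
\<close>

lemma limit_not_in_range:
  assumes lim: "\<And>a. a \<in> A \<Longrightarrow> (\<lambda>n. \<Phi> n a) \<longlonglongrightarrow> \<Psi> a"
    and r: "\<And>n. r n \<in> A" "\<And>n. \<Phi> n (r n) = p" "\<not> convergent r"
  shows "p \<notin> \<Psi> ` A"
proof
  assume "p \<in> \<Psi> ` A"
  then obtain a where a: "a \<in> A" "\<Psi> a = p" by blast
  have "(\<lambda>n. norm (\<Phi> n a - p)) \<longlonglongrightarrow> 0"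
    using lim[OF a(1)] a(2) by (simp add: LIM_zero tendsto_norm_zero)
  moreover have "norm (\<Phi> n a - p) = norm (a - r n)" for n
    using norm_\<Phi>[OF A_diff[OF a(1) r(1)], of n n] by (simp add: \<Phi>_diff a(1) r)
  ultimately have "(\<lambda>n. norm (r n - a)) \<longlonglongrightarrow> 0" by (simp add: norm_minus_commute)
  then have "r \<longlonglongrightarrow> a" using LIM_zero_cancel tendsto_norm_zero_iff by blast
  then show False using r(3) by (auto simp: convergent_def)
qed

end

text \<open>A pointwise limit of members of \<open>E\<close> meets the closure condition at every
  \<open>a\<close>, and as a limit of isometries it is bounded. Lying outside \<open>E\<close>, it
  refutes reflexivity.\<close>

lemma (in circle_extension) not_reflexive_if_limit:
  assumes E: "\<And>n. \<Phi> n \<in> E" "\<And>n a. a \<in> A \<Longrightarrow> norm (\<Phi> n a) = norm a"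
    and lim: "\<And>a. a \<in> A \<Longrightarrow> (\<lambda>n::nat. \<Phi> n a) \<longlonglongrightarrow> \<Psi> a"
    and \<Psi>: "\<Psi> \<in> star_endomorphisms A" "\<Psi> \<notin> E"
  shows "\<not> topologically_reflexive A E"
proof
  assume "topologically_reflexive A E"
  moreover have "norm (\<Psi> a) = norm a" if "a \<in> A" for a
    using tendsto_norm[OF lim[OF that]] E(2)[OF that] by (simp add: LIMSEQ_const_iff)
  then have "\<Psi> \<in> bounded_ops_on A"
    using \<Psi>(1) by (auto simp: bounded_ops_on_def star_endomorphisms_def intro!: exI[of _ 1])
  moreover have "\<Psi> a \<in> closure {F a |F. F \<in> E}" if "a \<in> A" for a
    using lim[OF that] E(1) by (auto simp: closure_sequential intro!: exI[of _ "\<lambda>n. \<Phi> n a"])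
  ultimately show False using \<Psi>(2) by (auto simp: topologically_reflexive_def)
qed

section \<open>Construction of the nonsurjective limit\<close>

lemma separable_dense_sequence:
  assumes "separable_space (euclidean :: 'h::topological_space topology)"
  obtains y :: "nat \<Rightarrow> 'h::topological_space" where "closure (range y) = UNIV"
proof -
  obtain D :: "'h::topological_space set" where D: "countable D" "closure D = UNIV"
    using assms by (auto simp: separable_space_def)
  then have "D \<noteq> {}" by auto
  then show thesis using that[of "from_nat_into D"] D by (simp add: range_from_nat_into)
qed

theorem theorem1p3:
  fixes A :: "('h::complex_hilbert_space \<Rightarrow>\<^sub>L 'h) set"
    and \<phi> :: "('h \<Rightarrow>\<^sub>L 'h) \<Rightarrow> complex \<Rightarrow> complex"
  assumes "infinite_dimensional TYPE('h)"
    and "separable_space (euclidean :: 'h topology)"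
    and "is_extension A \<phi>"
  shows "(\<exists>\<Phi> \<Psi>. (\<forall>n::nat. \<Phi> n \<in> star_automorphisms A) \<and>
            \<Psi> \<in> star_endomorphisms A \<and> \<Psi> ` A \<noteq> A \<and>
            (\<forall>a\<in>A. (\<lambda>n. \<Phi> n a) \<longlonglongrightarrow> \<Psi> a))
         \<and> \<not> topologically_reflexive A (automorphism_group A)
         \<and> \<not> topologically_reflexive A (isometry_group A)"
proof -
  interpret circle_extension A \<phi> by unfold_locales fact
  obtain y :: "nat \<Rightarrow> 'h" where y: "closure (range y) = UNIV"
    using separable_dense_sequence[OF assms(2)] .
  obtain T where T: "T \<in> A" "\<And>z. z \<in> unit_circle \<Longrightarrow> \<phi> T z = z"
    using lift_exists[of "\<lambda>z. z"] by auto
  obtain e where e: "\<And>n. norm (e n) = 1" "\<And>i n. i < n \<Longrightarrow> cinner (e n) (e i) = 0"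
    "\<And>i n. i < n \<Longrightarrow> cinner (e n) (y i) = 0"
    "\<And>n. norm (blinfun_apply T (e n) - e n) \<le> (1/2) ^ n"
    "\<And>n. norm (blinfun_apply (adj T) (e n) - e n) \<le> (1/2) ^ n"
    by (rule asymptotic_eigenbasis[OF T, of y]) (assumption, rule that)
  define f where "f n = e n - e (Suc n)" for n
  have e_orth: "cinner (e n) (e (Suc n)) = 0" for n
    using e(2)[of n "Suc n"] orthogonal_sym by blast
  have f: "(norm (f n))\<^sup>2 = 2" for n
    by (simp add: f_def norm_diff_sq e(1) e_orth)
  define \<alpha> where "\<alpha> n = (\<lambda>a\<in>A. conj_reflection (f n) a)" for n
  have \<alpha>: "\<alpha> n \<in> isometric_star_automorphisms A" for n
    unfolding \<alpha>_def by (rule conj_reflection_automorphism[OF f])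
  define \<Phi> where "\<Phi> = compose_seq A \<alpha>"
  interpret automorphism_sequence A \<phi> \<Phi>
    by unfold_locales (simp add: \<Phi>_def compose_seq_automorphism \<alpha>)
  have \<Phi>_Suc: "\<Phi> (Suc n) a = \<Phi> n (conj_reflection (f n) a)" if "a \<in> A" for n a
    using that by (simp add: \<Phi>_def \<alpha>_def compose_def)
  \<comment> \<open>\<open>\<Phi> (Suc n) a - \<Phi> n a\<close> is the image under
    \<open>\<Phi> n\<close> of the defect of \<open>a\<close> at stage \<open>n\<close> and has the
    same norm, so the telescoping series converges absolutely.\<close>
  have summable_conv: "a \<in> convergence_set"
    if a: "a \<in> A" and s: "summable (\<lambda>n. norm (conj_reflection (f n) a - a))" for a
  proof -
    have "norm (\<Phi> (Suc n) a - \<Phi> n a) = norm (conj_reflection (f n) a - a)" for n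
      using norm_\<Phi>[OF A_diff[OF conj_reflection_A[OF a] a], of n "f n"]
      by (simp add: \<Phi>_Suc \<Phi>_diff a conj_reflection_A)
    then have "summable (\<lambda>n. norm (\<Phi> (Suc n) a - \<Phi> n a))"
      using s by simp
    then have "summable (\<lambda>n. \<Phi> (Suc n) a - \<Phi> n a)" by (rule summable_norm_cancel)
    then have "convergent (\<lambda>n. (\<Sum>i<n. \<Phi> (Suc i) a - \<Phi> i a) + \<Phi> 0 a)"
      by (intro convergent_add convergent_const) (simp add: summable_iff_convergent)
    then show ?thesis using a by (simp add: convergence_set_def sum_lessThan_telescope[of "\<lambda>n. \<Phi> n a"])
  qed
  have "T \<in> convergence_set"
  proof (rule summable_conv[OF T(1)])
    have defect: "norm (blinfun_apply S (f n) - f n) \<le> 2 * (1/2) ^ n"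
      if "\<And>k. norm (blinfun_apply S (e k) - e k) \<le> (1/2) ^ k" for S n
    proof -
      have "blinfun_apply S (f n) - f n = (blinfun_apply S (e n) - e n) - (blinfun_apply S (e (Suc n)) - e (Suc n))"
        by (simp add: f_def blinfun.diff_right)
      then have "norm (blinfun_apply S (f n) - f n)
          \<le> norm (blinfun_apply S (e n) - e n) + norm (blinfun_apply S (e (Suc n)) - e (Suc n))"
        by (simp only: norm_triangle_ineq4)
      also have "\<dots> \<le> (1/2) ^ n + (1/2) ^ Suc n" by (intro add_mono that)
      also have "\<dots> \<le> 2 * (1/2) ^ n" by simp
      finally show ?thesis .
    qed
    have "norm (conj_reflection (f n) T - T) \<le> 8 * (1/2) ^ n" for n
    proof -
      have "norm (conj_reflection (f n) T - T)
          \<le> 2 * (norm (blinfun_apply T (f n) - f n) + norm (blinfun_apply (adj T) (f n) - f n))"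
        by (rule norm_conj_reflection_diff_le[OF A_cbounded[OF T(1)] f])
      also have "\<dots> \<le> 2 * (2 * (1/2) ^ n + 2 * (1/2) ^ n)"
        by (intro mult_left_mono add_mono defect e(4,5)) simp
      also have "\<dots> = 8 * (1/2) ^ n" by simp
      finally show ?thesis .
    qed
    then show "summable (\<lambda>n. norm (conj_reflection (f n) T - T))"
      by (intro summable_comparison_test'[OF summable_mult[OF summable_geometric], of "1/2" 0 _ 8]) simp_all
  qed
  moreover have "rank1 u v \<in> convergence_set" for u v
  proof -
    \<comment> \<open>Once \<open>n\<close> exceeds \<open>i\<close>, both \<open>e n\<close> and
      \<open>e (Suc n)\<close> are orthogonal to \<open>y i\<close>. Hence only finitely many
      defects of \<open>rank1 (y i) (y j)\<close> are nonzero.\<close>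
    have fixed: "blinfun_apply (reflection (f n)) (y i) = y i" if "i < n" for i n
    proof -
      have "cinner (y i) (e n) = 0" "cinner (y i) (e (Suc n)) = 0"
        using e(3)[of i n] e(3)[of i "Suc n"] that orthogonal_sym less_SucI by blast+
      then show ?thesis by (simp add: reflection_apply f_def cinner.diff_right)
    qed
    have 1: "rank1 (y i) (y j) \<in> convergence_set" for i j
    proof (rule summable_conv[OF rank1_A])
      have "norm (conj_reflection (f n) (rank1 (y i) (y j)) - rank1 (y i) (y j)) = 0"
        if "n \<notin> {..max i j}" for n
        using that by (simp add: conj_reflection_rank1 fixed)
      then show "summable (\<lambda>n. norm (conj_reflection (f n) (rank1 (y i) (y j)) - rank1 (y i) (y j)))"
        by (intro summable_finite[of "{..max i j}"]) auto
    qed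
    \<comment> \<open>Used once for each argument of \<open>rank1\<close>, to pass from the vectors
      \<open>y i\<close> to arbitrary ones.\<close>
    have dense: "w \<in> S" if "closed S" "\<And>i. y i \<in> S" for S w
      using closure_minimal[of "range y" S] that y by blast
    have "closed ((\<lambda>u. rank1 u (y j)) -` convergence_set)" for j
      by (intro closed_vimage convergence_set_closed continuous_intros rank1.continuous_on)
    then have 2: "rank1 u (y j) \<in> convergence_set" for u j
      using dense[of "(\<lambda>u. rank1 u (y j)) -` convergence_set" u] 1 by auto
    have "closed ((\<lambda>v. rank1 u v) -` convergence_set)"
      by (intro closed_vimage convergence_set_closed continuous_intros rank1.continuous_on)
    then show ?thesis
      using dense[of "(\<lambda>v. rank1 u v) -` convergence_set" v] 2 by auto
  qed
  moreover have "convergence_set \<subseteq> A" by (auto simp: convergence_set_def)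
  ultimately have "convergence_set = A"
    using T(2) by (intro subalgebra_eqI[of _ T] convergence_set_subspace convergence_set_comp
        convergence_set_adj convergence_set_closed)
  then obtain \<Psi> where \<Psi>: "\<Psi> \<in> star_endomorphisms A" "\<And>a. a \<in> A \<Longrightarrow> (\<lambda>n. \<Phi> n a) \<longlonglongrightarrow> \<Psi> a"
    using limit_star_endomorphism by blast
  define r where "r n = rank1 (e n) (e n)" for n
  \<comment> \<open>The innermost factor of \<open>\<Phi> (Suc n)\<close> takes
    \<open>r (Suc n)\<close> back to \<open>r n\<close>, so the value stays that of
    \<open>n = 0\<close>.\<close>
  have "\<Phi> n (r n) = rank1 (e 0) (e 0)" for n
  proof (induction n)
    case 0
    then show ?case by (simp add: \<Phi>_def r_def rank1_A)
  next
    case (Suc n)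
    have "cinner (e (Suc n)) (f n) = -1"
      using e(2)[of n "Suc n"] by (simp add: f_def cinner.diff_right cinner_self e(1))
    then have "blinfun_apply (reflection (f n)) (e (Suc n)) = e n"
      by (simp add: reflection_apply f_def)
    then show ?case
      using Suc by (simp add: \<Phi>_Suc r_def rank1_A conj_reflection_rank1)
  qed
  moreover have "\<not> convergent r"
  proof
    assume "convergent r"
    then obtain l where l: "r \<longlonglongrightarrow> l" by (auto simp: convergent_def)
    have "(\<lambda>n. r n - r (Suc n)) \<longlonglongrightarrow> l - l"
      by (intro tendsto_diff l LIMSEQ_Suc[OF l])
    then have "(\<lambda>n. norm (r n - r (Suc n))) \<longlonglongrightarrow> 0"
      using tendsto_norm_zero by simp
    \<comment> \<open>The unit vector \<open>e n\<close> is fixed by \<open>r n\<close> and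
      annihilated by \<open>r (Suc n)\<close>.\<close>
    moreover have "1 \<le> norm (r n - r (Suc n))" for n
    proof -
      have "blinfun_apply (r n - r (Suc n)) (e n) = e n"
        by (simp add: r_def blinfun.diff_left e_orth cinner_self e(1))
      then show ?thesis using norm_blinfun[of "r n - r (Suc n)" "e n"] by (simp add: e(1))
    qed
    ultimately have "(1::real) \<le> 0"
      by (intro LIMSEQ_le_const) auto
    then show False by simp
  qed
  ultimately have "rank1 (e 0) (e 0) \<notin> \<Psi> ` A"
    using limit_not_in_range[OF \<Psi>(2), of r] by (simp add: r_def rank1_A)
  then have range: "\<Psi> ` A \<noteq> A" using rank1_A by blast
  have "\<Phi> n \<in> star_automorphisms A" for n
    using automorphisms[of n] by (simp add: isometric_star_automorphisms_def)
  moreover have "\<not> topologically_reflexive A (automorphism_group A)"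
  proof (rule not_reflexive_if_limit[OF _ norm_\<Phi> \<Psi>(2,1)])
    show "\<Phi> n \<in> automorphism_group A" for n
      by (rule isometric_star_automorphisms_automorphism_group[OF automorphisms])
    show "\<Psi> \<notin> automorphism_group A"
      using range unfolding automorphism_group_def bij_betw_def by blast
  qed
  moreover have "\<not> topologically_reflexive A (isometry_group A)"
  proof (rule not_reflexive_if_limit[OF _ norm_\<Phi> \<Psi>(2,1)])
    show "\<Phi> n \<in> isometry_group A" for n
      by (rule isometric_star_automorphisms_isometry_group[OF automorphisms])
    show "\<Psi> \<notin> isometry_group A"
      using range unfolding isometry_group_def by blast
  qed
  ultimately show ?thesis using \<Psi> range by blast
qed

end
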